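(* Let $\chi=(\alpha_1,\alpha_2,\beta_1,\beta_2,\delta_1,\delta_2,\gamma)$ be a real vector with $\alpha_1>\alpha_2>0$, $\beta_1>\beta_2>0$, $\delta_1>\delta_2>0$ and $$\alpha_1+\alpha_2+\beta_1+\beta_2+\delta_1+\delta_2=3\gamma .$$ Then the $*$-algebra $\mathcal{A}_{\widetilde{E}_6,\chi}$ has a $*$-representation in generalized dimension $(1,1;1,1;1,1;3)$ if and only if all of the following inequalities hold: \begin{align*} &2(\alpha_1+\beta_1)>\alpha_2+\beta_2+\delta_1+\delta_2, && 2(\alpha_1+\delta_1)>\alpha_2+\beta_1+\beta_2+\delta_2,\\ &2(\beta_1+\delta_1)>\alpha_1+\alpha_2+\beta_2+\delta_2, && \alpha_1+\alpha_2+\beta_1+\delta_1>2(\beta_2+\delta_2),\\ &2(\alpha_2+\beta_2+\delta_1)>\alpha_1+\beta_1+\delta_2, && \alpha_1+\beta_1+\beta_2+\delta_1>2(\alpha_2+\delta_2),\\ &2(\alpha_2+\beta_1+\delta_2)>\alpha_1+\beta_2+\delta_1, && 2(\alpha_1+\beta_2+\delta_2)>\alpha_2+\beta_1+\delta_1,\\ &\alpha_1+\alpha_2+\beta_1+\beta_2+\delta_2>2\delta_1, && \alpha_1+\beta_1+\delta_1+\delta_2>2(\alpha_2+\beta_2),\\ &\alpha_1+\alpha_2+\beta_2+\delta_1+\delta_2>2\beta_1, && \alpha_2+\beta_1+\beta_2+\delta_1+\delta_2>2\alpha_1. \end{align*}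
   Context: The $*$-algebra $\mathcal{A}_{\widetilde{E}_6,\chi}$, associated with the extended Dynkin graph $\widetilde{E}_6$, is the unital complex $*$-algebra generated by self-adjoint idempotents $p_1,p_2,q_1,q_2,s_1,s_2$ with relations $p_1p_2=p_2p_1=0$, $q_1q_2=q_2q_1=0$, $s_1s_2=s_2s_1=0$ and $$\alpha_1p_1+\alpha_2p_2+\beta_1q_1+\beta_2q_2+\delta_1s_1+\delta_2s_2=\gamma e,$$ where $e$ is the identity. A $*$-representation $\pi$ on a finite-dimensional Hilbert space $H_0$ has generalized dimension $(\operatorname{rank}\pi(p_1),\operatorname{rank}\pi(p_2);\operatorname{rank}\pi(q_1),\operatorname{rank}\pi(q_2);\operatorname{rank}\pi(s_1),\operatorname{rank}\pi(s_2);\dim H_0)$. Thus generalized dimension $(1,1;1,1;1,1;3)$ means three Hermitian $3\times3$ matrices with simple spectra $\{0,\alpha_1,\alpha_2\}$, $\{0,\beta_1,\beta_2\}$, $\{0,\delta_1,\delta_2\}$ whose sum is $\gamma I$.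
   Formalization: "Has a *-representation" is read as "has an irreducible *-representation": for arbitrary ones "only if" fails, e.g. α=(3,2), β=(7/2,2), δ=(1,1/2), γ=4 with diag(3,2,0)+diag(0,2,7/2)+diag(1,0,1/2)=4I, where α1+β1+δ1+δ2=2(α2+β2). *)

theory Defs
  imports
    "HOL-Analysis.Analysis"
    "HOL-Library.Poly_Mapping"
    "HOL-Algebra.Module"
    "HOL-Algebra.QuotRing"
begin

text \<open>
  Words under concatenation form a (non-commutative) monoid, written additively so that
  finitely supported functions on words carry the convolution product of
  \<^theory>\<open>HOL-Library.Poly_Mapping\<close>: they are the non-commutative polynomials.
\<close>

instantiation list :: (type) monoid_add
begin

definition zero_list :: "'a list" where "zero_list = []"

definition plus_list :: "'a list \<Rightarrow> 'a list \<Rightarrow> 'a list" where "plus_list u v = u @ v"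

instance
  by standard (simp_all add: zero_list_def plus_list_def)

end

subsection \<open>Unital complex *-algebras by generators and relations\<close>

record 'a star_algebra = "(complex, 'a) module" +
  star :: "'a \<Rightarrow> 'a"

text \<open>
  The free unital *-algebra on a set of self-adjoint generators: \<open>star\<close> reverses words and
  conjugates coefficients. The scalar \<open>c\<close> is \<open>c\<close> times the empty word.
\<close>

definition free_star_algebra :: "('g list \<Rightarrow>\<^sub>0 complex) star_algebra" where
  "free_star_algebra =
    \<lparr> carrier = UNIV, mult = (*), one = 1, zero = 0, add = (+),
      smult = (\<lambda>c f. Poly_Mapping.single [] c * f),
      star = (\<lambda>f. Poly_Mapping.map cnj (Poly_Mapping.map_key rev f)) \<rparr>"

definition generator :: "'g \<Rightarrow> ('g list \<Rightarrow>\<^sub>0 complex)" where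
  "generator x = Poly_Mapping.single [x] 1"

text \<open>
  \<open>I\<close> is meant to be a two-sided ideal closed under scalars and \<open>star\<close>. Scalar multiplication
  and \<open>star\<close> on cosets follow the pattern of \<^const>\<open>rcoset_mult\<close>.
\<close>

definition quotient_star_algebra :: "'a star_algebra \<Rightarrow> 'a set \<Rightarrow> 'a set star_algebra" where
  "quotient_star_algebra A I =
    ring.extend (A Quot I)
      \<lparr> smult = (\<lambda>c X. \<Union>x\<in>X. I +>\<^bsub>A\<^esub> (c \<odot>\<^bsub>A\<^esub> x)),
        star = (\<lambda>X. \<Union>x\<in>X. I +>\<^bsub>A\<^esub> star A x) \<rparr>"

subsection \<open>The *-algebra of the extended Dynkin graph $\widetilde{E}_6$\<close>

datatype E6_gen = P1 | P2 | Q1 | Q2 | S1 | S2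

text \<open>
  The two-sided ideal generated by these relators is closed under \<open>star\<close>, since the set of
  relators is (the coefficients are real).
\<close>

definition E6_relators ::
    "real \<Rightarrow> real \<Rightarrow> real \<Rightarrow> real \<Rightarrow> real \<Rightarrow> real \<Rightarrow> real \<Rightarrow> (E6_gen list \<Rightarrow>\<^sub>0 complex) set" where
  "E6_relators \<alpha>1 \<alpha>2 \<beta>1 \<beta>2 \<delta>1 \<delta>2 \<gamma> =
    (let F = free_star_algebra; g = generator; sc = (\<lambda>r f. complex_of_real r \<odot>\<^bsub>F\<^esub> f) in
      {g x * g x - g x | x. True} \<union>
      {g P1 * g P2, g P2 * g P1, g Q1 * g Q2, g Q2 * g Q1, g S1 * g S2, g S2 * g S1} \<union>
      {sc \<alpha>1 (g P1) + sc \<alpha>2 (g P2) + sc \<beta>1 (g Q1) + sc \<beta>2 (g Q2)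
         + sc \<delta>1 (g S1) + sc \<delta>2 (g S2) - sc \<gamma> 1})"

definition E6_ideal ::
    "real \<Rightarrow> real \<Rightarrow> real \<Rightarrow> real \<Rightarrow> real \<Rightarrow> real \<Rightarrow> real \<Rightarrow> (E6_gen list \<Rightarrow>\<^sub>0 complex) set" where
  "E6_ideal \<alpha>1 \<alpha>2 \<beta>1 \<beta>2 \<delta>1 \<delta>2 \<gamma> =
    Idl\<^bsub>free_star_algebra\<^esub> (E6_relators \<alpha>1 \<alpha>2 \<beta>1 \<beta>2 \<delta>1 \<delta>2 \<gamma>)"

definition E6_algebra ::
    "real \<Rightarrow> real \<Rightarrow> real \<Rightarrow> real \<Rightarrow> real \<Rightarrow> real \<Rightarrow> real \<Rightarrow> (E6_gen list \<Rightarrow>\<^sub>0 complex) set star_algebra"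
  where
  "E6_algebra \<alpha>1 \<alpha>2 \<beta>1 \<beta>2 \<delta>1 \<delta>2 \<gamma> =
    quotient_star_algebra free_star_algebra (E6_ideal \<alpha>1 \<alpha>2 \<beta>1 \<beta>2 \<delta>1 \<delta>2 \<gamma>)"

definition E6_elem ::
    "real \<Rightarrow> real \<Rightarrow> real \<Rightarrow> real \<Rightarrow> real \<Rightarrow> real \<Rightarrow> real \<Rightarrow> E6_gen \<Rightarrow> (E6_gen list \<Rightarrow>\<^sub>0 complex) set" where
  "E6_elem \<alpha>1 \<alpha>2 \<beta>1 \<beta>2 \<delta>1 \<delta>2 \<gamma> x =
    E6_ideal \<alpha>1 \<alpha>2 \<beta>1 \<beta>2 \<delta>1 \<delta>2 \<gamma> +>\<^bsub>free_star_algebra\<^esub> generator x"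

subsection \<open>*-representations\<close>

text \<open>
  Representations act on \<open>complex ^ 'n\<close> with its standard Hermitian inner product, to which every
  complex Hilbert space of finite dimension \<open>CARD('n)\<close> is isometric; the adjoint of an operator is
  then the conjugate transpose of its matrix.
\<close>

definition adjoint_matrix :: "complex ^ 'n ^ 'm \<Rightarrow> complex ^ 'm ^ 'n" where
  "adjoint_matrix M = (\<chi> i j. cnj (M $ j $ i))"

definition star_representation :: "'a star_algebra \<Rightarrow> ('a \<Rightarrow> complex ^ 'n ^ 'n) \<Rightarrow> bool" where
  "star_representation A \<pi> \<longleftrightarrow>
    \<pi> \<one>\<^bsub>A\<^esub> = mat 1 \<and>
    (\<forall>x\<in>carrier A. \<forall>y\<in>carrier A. \<pi> (x \<oplus>\<^bsub>A\<^esub> y) = \<pi> x + \<pi> y) \<and>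
    (\<forall>x\<in>carrier A. \<forall>y\<in>carrier A. \<pi> (x \<otimes>\<^bsub>A\<^esub> y) = \<pi> x ** \<pi> y) \<and>
    (\<forall>c. \<forall>x\<in>carrier A. \<pi> (c \<odot>\<^bsub>A\<^esub> x) = mat c ** \<pi> x) \<and>
    (\<forall>x\<in>carrier A. \<pi> (star A x) = adjoint_matrix (\<pi> x))"

text \<open>
  Strict Horn inequalities characterize irreducible representations; reducible ones also occur on
  the boundary: $\mathrm{diag}(3,2,0) + \mathrm{diag}(0,2,\frac72) + \mathrm{diag}(1,0,\frac12) = 4I$
  has $\alpha_1+\beta_1+\delta_1+\delta_2 = 2(\alpha_2+\beta_2)$.
\<close>

definition irreducible_representation :: "'a star_algebra \<Rightarrow> ('a \<Rightarrow> complex ^ 'n ^ 'n) \<Rightarrow> bool" where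
  "irreducible_representation A \<pi> \<longleftrightarrow>
    (\<forall>W. vec.subspace W \<and> (\<forall>x\<in>carrier A. \<forall>v\<in>W. \<pi> x *v v \<in> W) \<longrightarrow> W = {0} \<or> W = UNIV)"

definition generalized_dimension ::
    "real \<Rightarrow> real \<Rightarrow> real \<Rightarrow> real \<Rightarrow> real \<Rightarrow> real \<Rightarrow> real
      \<Rightarrow> ((E6_gen list \<Rightarrow>\<^sub>0 complex) set \<Rightarrow> complex ^ 'n ^ 'n)
      \<Rightarrow> (nat \<times> nat) \<times> (nat \<times> nat) \<times> (nat \<times> nat) \<times> nat" where
  "generalized_dimension \<alpha>1 \<alpha>2 \<beta>1 \<beta>2 \<delta>1 \<delta>2 \<gamma> \<pi> =
    (let r = (\<lambda>x. rank (\<pi> (E6_elem \<alpha>1 \<alpha>2 \<beta>1 \<beta>2 \<delta>1 \<delta>2 \<gamma> x))) in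
      ((r P1, r P2), (r Q1, r Q2), (r S1, r S2), CARD('n)))"

end

theory Submission
  imports Defs
begin

text \<open>
  Write \<open>A = \<alpha>1 p1 + \<alpha>2 p2\<close>, let \<open>a1 > a2 > a3 = 0\<close> be its eigenvalues, and treat \<open>B\<close> with
  eigenvalues \<open>b\<close> and \<open>C\<close> with eigenvalues \<open>c\<close> in the same way. Generators and relations say that a
  representation is a choice of six projections, so the theorem is about triples of Hermitian
  3 by 3 matrices with these simple spectra, with \<open>A + B + C = \<gamma>\<close> and with no common invariant
  subspace. By the trace condition, and up to a factor 3, the twelve inequalities read
  \<open>\<gamma> < a_i + b_j + c_k\<close> for \<open>i + j + k = 5\<close> and \<open>a_i + b_j + c_k < \<gamma>\<close> for \<open>i + j + k = 7\<close>.

  Necessity is the argument of Weyl (\<open>weyl_strict\<close>). The eigenvectors of \<open>A\<close> with index at least \<open>i\<close>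
  span a space of codimension \<open>i - 1\<close>. For \<open>i + j + k = 5\<close> the three codimensions add up to 2, so
  some \<open>v \<noteq> 0\<close> lies in all three spaces, and the quadratic form of \<open>A + B + C\<close> at \<open>v\<close> shows
  \<open>\<gamma> \<le> a_i + b_j + c_k\<close>. Equality would make \<open>v\<close> a common eigenvector and its span invariant. The
  case \<open>i + j + k = 7\<close> is the same statement for \<open>-A\<close>, \<open>-B\<close>, \<open>-C\<close>.

  Sufficiency is the principle of Kempf and Ness. Fix three flags, a line inside a plane, in
  general position in real 3-space. For an invertible \<open>g\<close>, let \<open>p1\<close> project onto the image under
  \<open>g\<close> of the first line and \<open>p2\<close> onto its orthogonal complement in the image of the first plane,
  and so on for the other flags. The requirement \<open>A + B + C = \<gamma>\<close> is then the Euler-Lagrange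
  equation of the function \<open>flag_energy\<close> of \<open>g\<close>, which adds up weighted logarithms of the lengths
  and areas that \<open>g\<close> produces on the flags (\<open>flag_energy_critical\<close>). So it is enough to minimise
  this function. In a basis of singular vectors of \<open>g\<close> its growth at infinity is governed by the
  position of the most contracted line and of the plane orthogonal to the most expanded direction
  relative to the flags. Flags in general position allow only few positions, and the resulting
  conditions are exactly the twelve inequalities (\<open>line_slack_cases\<close>, \<open>plane_slack_cases\<close>,
  \<open>flag_energy_growth\<close>). Hence a minimiser exists, and since general position survives the
  application of \<open>g\<close>, the representation is irreducible (\<open>generic_flags_irreducible\<close>).
\<close>

unbundle cross3_syntax

section \<open>The free *-algebra and its quotients\<close>

text \<open>
  Multiplicative statements about convolution only need to be checked on single words; sums
  are handled by additivity.
\<close>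

lemma poly_mapping_single_add_induct [case_names single add]:
  fixes f :: "'k \<Rightarrow>\<^sub>0 'c::comm_monoid_add"
  assumes single: "\<And>w c. P (Poly_Mapping.single w c)"
    and add: "\<And>f g. P f \<Longrightarrow> P g \<Longrightarrow> P (f + g)"
  shows "P f"
proof (induction f rule: Poly_Mapping.update_induct)
  case const
  show ?case using single[of undefined 0] by simp
next
  case (update f a b)
  have "Poly_Mapping.update a b f = f + Poly_Mapping.single a b"
    by (rule poly_mapping_eqI)
      (use update in \<open>auto simp: lookup_update lookup_add lookup_single when_def in_keys_iff\<close>)
  then show ?case using add update single by metis
qed

lemma ring_free_star_algebra: "ring (free_star_algebra :: ('g list \<Rightarrow>\<^sub>0 complex) star_algebra)"
proof (rule ringI)
  show "abelian_group (free_star_algebra :: ('g list \<Rightarrow>\<^sub>0 complex) star_algebra)"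
    by (rule abelian_groupI)
      (auto simp: free_star_algebra_def algebra_simps intro: exI[of _ "- _"])
  show "Group.monoid (free_star_algebra :: ('g list \<Rightarrow>\<^sub>0 complex) star_algebra)"
    by (rule monoidI) (auto simp: free_star_algebra_def mult.assoc)
qed (auto simp: free_star_algebra_def algebra_simps)

lemma free_star_algebra_simps [simp]:
  "carrier free_star_algebra = UNIV" "mult free_star_algebra = (*)" "one free_star_algebra = 1"
  "zero free_star_algebra = 0" "add free_star_algebra = (+)"
  "smult free_star_algebra = (\<lambda>c f. Poly_Mapping.single [] c * f)"
  by (simp_all add: free_star_algebra_def)

abbreviation free_star :: "('g list \<Rightarrow>\<^sub>0 complex) \<Rightarrow> ('g list \<Rightarrow>\<^sub>0 complex)" where
  "free_star \<equiv> star free_star_algebra"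

lemma lookup_free_star: "Poly_Mapping.lookup (free_star f) w = cnj (Poly_Mapping.lookup f (rev w))"
  by (simp add: free_star_algebra_def Poly_Mapping.map.rep_eq map_key.rep_eq when_def)

lemma free_star_add: "free_star (f + g) = free_star f + free_star g"
  by (rule poly_mapping_eqI) (simp add: lookup_free_star lookup_add)

lemma free_star_diff: "free_star (f - g) = free_star f - free_star g"
  by (rule poly_mapping_eqI) (simp add: lookup_free_star lookup_minus)

lemma free_star_single [simp]:
  "free_star (Poly_Mapping.single w c) = Poly_Mapping.single (rev w) (cnj c)"
  by (rule poly_mapping_eqI) (auto simp: lookup_free_star lookup_single when_def)

lemma free_star_mult: "free_star (f * g) = free_star g * free_star f"
proof (induction f rule: poly_mapping_single_add_induct)
  case (single w c)
  show ?case
    by (induction g rule: poly_mapping_single_add_induct)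
      (simp_all add: mult_single plus_list_def free_star_add algebra_simps)
qed (simp add: free_star_add algebra_simps)

text \<open>
  Scalars are multiples of the empty word, which is the neutral element of the monoid.
\<close>

lemma single_Nil_mult_commute:
  fixes f :: "'g list \<Rightarrow>\<^sub>0 complex"
  shows "Poly_Mapping.single [] c * f = f * Poly_Mapping.single [] c"
  by (induction f rule: poly_mapping_single_add_induct)
    (simp_all add: mult_single plus_list_def algebra_simps)

context
  fixes I :: "('g list \<Rightarrow>\<^sub>0 complex) set"
  assumes I: "ideal I free_star_algebra"
begin

abbreviation (input) "coset x \<equiv> I +>\<^bsub>free_star_algebra\<^esub> x"

lemma coset_eq_iff: "coset x = coset y \<longleftrightarrow> x - y \<in> I"
proof -
  interpret ideal I "free_star_algebra :: ('g list \<Rightarrow>\<^sub>0 complex) star_algebra" by (rule I)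
  have add: "u \<in> I \<Longrightarrow> v \<in> I \<Longrightarrow> u + v \<in> I" for u v 
    using additive_subgroup.a_closed[OF ideal.axioms(1)[OF I], of u v] by simp
  have zero: "0 \<in> I"
    using additive_subgroup.zero_closed[OF ideal.axioms(1)[OF I]] by simp
  have neg: "- u \<in> I" if "u \<in> I" for u
    using I_l_closed[OF that, of "-1"] by simp
  have mem: "z \<in> coset x \<longleftrightarrow> z - x \<in> I" for x z
    by (auto simp: a_r_coset_def' intro!: bexI[of _ "z - x"])
  show ?thesis
  proof
    assume "coset x = coset y"
    then have "x \<in> coset y" using mem[of x x] zero by simp
    then show "x - y \<in> I" by (simp add: mem)
  next
    assume d: "x - y \<in> I"
    show "coset x = coset y"
    proof (rule Set.set_eqI)
      fix z
      show "z \<in> coset x \<longleftrightarrow> z \<in> coset y"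
        unfolding mem using add[OF _ d, of "z - x"] add[OF _ neg[OF d], of "z - y"] by auto
    qed
  qed
qed

lemma mem_coset_iff: "z \<in> coset x \<longleftrightarrow> z - x \<in> I"
    by (auto simp: a_r_coset_def' intro!: bexI[of _ "z - x"])

text \<open>
  An operation on representatives that respects the ideal gives the same coset for every
  representative, so the union that defines the operation on cosets collapses.
\<close>

lemma UN_coset_const:
  assumes "\<And>z. z - x \<in> I \<Longrightarrow> h z - h x \<in> I"
  shows "(\<Union>z\<in>coset x. coset (h z)) = coset (h x)"
proof -
  have "x \<in> coset x"
    using additive_subgroup.zero_closed[OF ideal.axioms(1)[OF I]] by (simp add: mem_coset_iff)
  moreover have "coset (h z) = coset (h x)" if "z \<in> coset x" for z
    using assms[of z] that by (simp add: coset_eq_iff mem_coset_iff)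
  ultimately show ?thesis by blast
qed

lemma quotient_star_algebra_simps:
  assumes star: "\<And>f. f \<in> I \<Longrightarrow> free_star f \<in> I"
  defines "Q \<equiv> quotient_star_algebra free_star_algebra I"
  shows "carrier Q = range coset" "one Q = coset 1"
    "add Q (coset x) (coset y) = coset (x + y)"
    "mult Q (coset x) (coset y) = coset (x * y)"
    "smult Q c (coset x) = coset (Poly_Mapping.single [] c * x)"
    "star Q (coset x) = coset (free_star x)"
proof -
  interpret ideal I "free_star_algebra :: ('g list \<Rightarrow>\<^sub>0 complex) star_algebra" by (rule I)
  note defs = Q_def quotient_star_algebra_def ring.defs FactRing_def
  show "carrier Q = range coset" "one Q = coset 1"
    by (auto simp: defs A_RCOSETS_def' )
  show "add Q (coset x) (coset y) = coset (x + y)"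
    using a_rcos_sum[of x y] by (simp add: defs)
  show "mult Q (coset x) (coset y) = coset (x * y)"
    using rcoset_mult_add[of x y] by (simp add: defs)
  have "Poly_Mapping.single [] c * f \<in> I" if "f \<in> I" for f
    using I_l_closed[OF that, of "Poly_Mapping.single [] c"] by simp
  then show "smult Q c (coset x) = coset (Poly_Mapping.single [] c * x)"
    using UN_coset_const[of x "\<lambda>z. Poly_Mapping.single [] c * z"]
    by (simp add: defs right_diff_distrib[symmetric])
  show "star Q (coset x) = coset (free_star x)"
    using UN_coset_const[of x free_star] star
    by (simp add: defs free_star_diff[symmetric])
qed

end

lemma ideal_free_star_algebraI:
  fixes J :: "('g list \<Rightarrow>\<^sub>0 complex) set"
  assumes zero: "0 \<in> J" and add: "\<And>f g. f \<in> J \<Longrightarrow> g \<in> J \<Longrightarrow> f + g \<in> J"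
    and left: "\<And>f h. f \<in> J \<Longrightarrow> h * f \<in> J" and right: "\<And>f h. f \<in> J \<Longrightarrow> f * h \<in> J"
  shows "ideal J free_star_algebra"
proof (rule idealI)
  show "ring (free_star_algebra :: ('g list \<Rightarrow>\<^sub>0 complex) star_algebra)"
    by (rule ring_free_star_algebra)
  then interpret F: ring "free_star_algebra :: ('g list \<Rightarrow>\<^sub>0 complex) star_algebra" .
  show "subgroup J (add_monoid free_star_algebra)"
  proof (rule group.subgroupI)
    show "group (add_monoid (free_star_algebra :: ('g list \<Rightarrow>\<^sub>0 complex) star_algebra))"
      by (rule F.add.is_group)
    fix f assume "f \<in> J"
    then have "- f \<in> J" using left[of f "-1"] by simp
    moreover have "inv\<^bsub>add_monoid free_star_algebra\<^esub> f = - f"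
      using F.minus_equality[of "- f" f] by (simp add: a_inv_def)
    ultimately show "inv\<^bsub>add_monoid free_star_algebra\<^esub> f \<in> J" by simp
  qed (use zero add in auto)
qed (use left right in auto)

text \<open>
  The elements whose star lies in the ideal form an ideal themselves, so the closure under the
  star needs to be checked on relators only.
\<close>

lemma free_star_genideal:
  assumes "\<And>r. r \<in> R \<Longrightarrow> free_star r \<in> Idl\<^bsub>free_star_algebra\<^esub> R"
    and "f \<in> Idl\<^bsub>free_star_algebra\<^esub> R"
  shows "free_star f \<in> Idl\<^bsub>free_star_algebra\<^esub> R"
proof -
  interpret F: ring "free_star_algebra :: ('a list \<Rightarrow>\<^sub>0 complex) star_algebra"
    by (rule ring_free_star_algebra)
  let ?I = "Idl\<^bsub>free_star_algebra\<^esub> R"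
  interpret I: ideal ?I "free_star_algebra :: ('a list \<Rightarrow>\<^sub>0 complex) star_algebra"
    by (rule F.genideal_ideal) simp
  have "ideal {f. free_star f \<in> ?I} free_star_algebra"
  proof (rule ideal_free_star_algebraI)
    have "free_star (0 :: 'a list \<Rightarrow>\<^sub>0 complex) = 0" using free_star_diff[of 0 0] by simp
    then show "0 \<in> {f. free_star f \<in> ?I}"
      using additive_subgroup.zero_closed[OF I.is_additive_subgroup] by simp
    show "f + g \<in> {f. free_star f \<in> ?I}"
      if "f \<in> {f. free_star f \<in> ?I}" "g \<in> {f. free_star f \<in> ?I}" for f g
      using that additive_subgroup.a_closed[OF I.is_additive_subgroup]
      by (simp add: free_star_add)
  qed (use I.I_l_closed I.I_r_closed in \<open>auto simp: free_star_mult\<close>)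
  then have "?I \<subseteq> {f. free_star f \<in> ?I}"
    by (rule F.genideal_minimal) (use assms in auto)
  then show ?thesis using assms by auto
qed

section \<open>Representations as families of matrices\<close>

primrec word_matrix :: "('g \<Rightarrow> complex ^ 'n ^ 'n) \<Rightarrow> 'g list \<Rightarrow> complex ^ 'n ^ 'n" where
  "word_matrix M [] = mat 1"
| "word_matrix M (x # w) = M x ** word_matrix M w"

text \<open>
  The homomorphism that sends each generator \<open>x\<close> to \<open>M x\<close>.
\<close>

definition eval_matrix ::
    "('g \<Rightarrow> complex ^ 'n ^ 'n) \<Rightarrow> ('g list \<Rightarrow>\<^sub>0 complex) \<Rightarrow> complex ^ 'n ^ 'n" where
  "eval_matrix M f = (\<Sum>w\<in>Poly_Mapping.keys f. mat (Poly_Mapping.lookup f w) ** word_matrix M w)"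

lemma word_matrix_append: "word_matrix M (u @ v) = word_matrix M u ** word_matrix M v"
  by (induction u) (simp_all add: matrix_mul_assoc)

lemma mat_mult_nth: "(mat c ** A) $ i $ j = c * A $ i $ j" for A :: "'a::comm_semiring_1 ^ 'n ^ 'm"
  by (simp add: matrix_matrix_mult_def mat_def if_distrib[where f="\<lambda>x. x * _"] sum.delta' cong: if_cong)

lemma mat_mult_commute: "mat c ** A = A ** mat c" for A :: "'a::comm_semiring_1 ^ 'n ^ 'n"
proof -
  have "(A ** mat c) $ i $ j = c * A $ i $ j" for i j
    by (simp add: matrix_matrix_mult_def mat_def if_distrib[where f="\<lambda>x. _ * x"] sum.delta mult.commute cong: if_cong)
  then show ?thesis by (simp add: vec_eq_iff mat_mult_nth)
qed

lemma mat_vector_mult: "mat c *v u = c *s u" for u :: "'a::comm_semiring_1 ^ 'n"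
  by (simp add: vec_eq_iff matrix_vector_mult_def mat_def if_distrib[where f="\<lambda>x. x * _"]
      sum.delta' cong: if_cong)

lemma mat_add: "mat (a + b) = mat a + (mat b :: 'a::comm_semiring_1 ^ 'n ^ 'n)"
  by (simp add: vec_eq_iff mat_def)

lemma mat_mult: "mat (a * b) = mat a ** (mat b :: 'a::comm_semiring_1 ^ 'n ^ 'n)"
  by (simp only: vec_eq_iff mat_mult_nth) (simp add: mat_def)

lemma matrix_add_distrib_right: "(A + B) ** C = A ** C + B ** C" for A :: "'a::comm_semiring_1 ^ 'n ^ 'm"
  by (simp add: matrix_matrix_mult_def vec_eq_iff algebra_simps sum.distrib)

lemma eval_matrix_superset:
  assumes "finite S" "Poly_Mapping.keys f \<subseteq> S"
  shows "eval_matrix M f = (\<Sum>w\<in>S. mat (Poly_Mapping.lookup f w) ** word_matrix M w)"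
  unfolding eval_matrix_def
  by (rule sum.mono_neutral_left) (use assms in \<open>auto simp: in_keys_iff\<close>)

lemma eval_matrix_add: "eval_matrix M (f + g) = eval_matrix M f + eval_matrix M g"
proof -
  have "Poly_Mapping.keys (f + g) \<subseteq> Poly_Mapping.keys f \<union> Poly_Mapping.keys g" by (rule Poly_Mapping.keys_add)
  then show ?thesis
    using eval_matrix_superset[of "Poly_Mapping.keys f \<union> Poly_Mapping.keys g" _ M]
    by (simp add: lookup_add mat_add matrix_add_distrib_right sum.distrib)
qed

lemma eval_matrix_single: "eval_matrix M (Poly_Mapping.single w c) = mat c ** word_matrix M w"
  by (simp add: eval_matrix_def)

lemma eval_matrix_mult: "eval_matrix M (f * g) = eval_matrix M f ** eval_matrix M g"
proof (induction f rule: poly_mapping_single_add_induct)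
  case (single u c)
  show ?case
  proof (induction g rule: poly_mapping_single_add_induct)
    case (single v d)
    have "mat (c * d) ** (word_matrix M u ** word_matrix M v)
      = mat c ** word_matrix M u ** (mat d ** word_matrix M v)"
      by (metis mat_mult mat_mult_commute matrix_mul_assoc)
    then show ?case
      by (simp add: mult_single eval_matrix_single plus_list_def word_matrix_append)
  qed (simp add: eval_matrix_add distrib_left matrix_add_ldistrib)
qed (simp add: eval_matrix_add distrib_right matrix_add_distrib_right)

lemma eval_matrix_one: "eval_matrix M 1 = mat 1"
  unfolding Poly_Mapping.single_one[symmetric] by (simp add: eval_matrix_single zero_list_def)

lemma eval_matrix_generator: "eval_matrix M (generator x) = M x"
  by (simp add: generator_def eval_matrix_single)

lemma eval_matrix_diff: "eval_matrix M (f - g) = eval_matrix M f - eval_matrix M g"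
  using eval_matrix_add[of M "f - g" g] by (simp add: algebra_simps)

lemma adjoint_matrix_mult: "adjoint_matrix (A ** B) = adjoint_matrix B ** adjoint_matrix A"
  by (simp add: adjoint_matrix_def matrix_matrix_mult_def vec_eq_iff mult.commute)

lemma adjoint_matrix_add: "adjoint_matrix (A + B) = adjoint_matrix A + adjoint_matrix B"
  by (simp add: adjoint_matrix_def vec_eq_iff)

lemma adjoint_matrix_mat: "adjoint_matrix (mat c) = mat (cnj c)"
  by (simp add: adjoint_matrix_def vec_eq_iff mat_def)

lemma eval_matrix_star:
  assumes "\<And>x. adjoint_matrix (M x) = M x"
  shows "eval_matrix M (free_star f) = adjoint_matrix (eval_matrix M f)"
proof (induction f rule: poly_mapping_single_add_induct)
  case (single w c)
  have "word_matrix M (rev w) = adjoint_matrix (word_matrix M w)"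
    by (induction w) (simp_all add: adjoint_matrix_mat word_matrix_append adjoint_matrix_mult assms)
  then show ?case
    by (simp add: eval_matrix_single adjoint_matrix_mult adjoint_matrix_mat mat_mult_commute)
qed (simp add: free_star_add eval_matrix_add adjoint_matrix_add)

lemma eval_matrix_genideal:
  assumes "\<And>r. r \<in> R \<Longrightarrow> eval_matrix M r = 0" "f \<in> Idl\<^bsub>free_star_algebra\<^esub> R"
  shows "eval_matrix M f = 0"
proof -
  interpret F: ring "free_star_algebra :: ('a list \<Rightarrow>\<^sub>0 complex) star_algebra"
    by (rule ring_free_star_algebra)
  have "ideal {f. eval_matrix M f = 0} free_star_algebra"
    by (rule ideal_free_star_algebraI)
      (auto simp: eval_matrix_add eval_matrix_mult, simp add: eval_matrix_def)
  then have "Idl\<^bsub>free_star_algebra\<^esub> R \<subseteq> {f. eval_matrix M f = 0}"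
    by (rule F.genideal_minimal) (use assms in auto)
  then show ?thesis using assms by auto
qed

definition common_invariant :: "('g \<Rightarrow> complex ^ 'n ^ 'n) \<Rightarrow> (complex ^ 'n) set \<Rightarrow> bool" where
  "common_invariant M W \<longleftrightarrow> vec.subspace W \<and> (\<forall>x. \<forall>v\<in>W. M x *v v \<in> W)"

text \<open>
  A subspace invariant under the generators is invariant under every word in them. This is why
  irreducibility can be tested on the generators.
\<close>

lemma common_invariant_eval_matrix:
  assumes "common_invariant M W" "v \<in> W"
  shows "eval_matrix M f *v v \<in> W"
proof -
  have W: "vec.subspace W" and M: "\<And>x v. v \<in> W \<Longrightarrow> M x *v v \<in> W"
    using assms(1) by (auto simp: common_invariant_def)
  show ?thesis
  proof (induction f rule: poly_mapping_single_add_induct)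
    case (single w c)
    have "word_matrix M w *v v \<in> W"
      by (induction w) (use assms(2) M in \<open>auto simp: matrix_vector_mul_assoc[symmetric]\<close>)
    then show ?case
      using W by (simp add: mat_vector_mult eval_matrix_single matrix_vector_mul_assoc[symmetric] vec.subspace_scale)
  next
    case (add f g)
    then show ?case
      using W by (simp add: eval_matrix_add matrix_vector_mult_add_rdistrib vec.subspace_add)
  qed
qed

context
  fixes \<alpha>1 \<alpha>2 \<beta>1 \<beta>2 \<delta>1 \<delta>2 \<gamma> :: real
begin

definition E6_relations :: "(E6_gen \<Rightarrow> complex ^ 'n ^ 'n) \<Rightarrow> bool" where
  "E6_relations M \<longleftrightarrow>
    (\<forall>x. adjoint_matrix (M x) = M x \<and> M x ** M x = M x) \<and>
    M P1 ** M P2 = 0 \<and> M P2 ** M P1 = 0 \<and> M Q1 ** M Q2 = 0 \<and> M Q2 ** M Q1 = 0 \<and>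
    M S1 ** M S2 = 0 \<and> M S2 ** M S1 = 0 \<and>
    mat (of_real \<alpha>1) ** M P1 + mat (of_real \<alpha>2) ** M P2 + mat (of_real \<beta>1) ** M Q1
      + mat (of_real \<beta>2) ** M Q2 + mat (of_real \<delta>1) ** M S1 + mat (of_real \<delta>2) ** M S2
      = mat (of_real \<gamma>)"

abbreviation (input) "E6_algebra' \<equiv> E6_algebra \<alpha>1 \<alpha>2 \<beta>1 \<beta>2 \<delta>1 \<delta>2 \<gamma>"
abbreviation (input) "E6_ideal' \<equiv> E6_ideal \<alpha>1 \<alpha>2 \<beta>1 \<beta>2 \<delta>1 \<delta>2 \<gamma>"
abbreviation (input) "E6_relators' \<equiv> E6_relators \<alpha>1 \<alpha>2 \<beta>1 \<beta>2 \<delta>1 \<delta>2 \<gamma>"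
abbreviation (input) "E6_elem' \<equiv> E6_elem \<alpha>1 \<alpha>2 \<beta>1 \<beta>2 \<delta>1 \<delta>2 \<gamma>"
abbreviation (input) "cls x \<equiv> E6_ideal' +>\<^bsub>free_star_algebra\<^esub> x"

lemma ideal_E6: "ideal E6_ideal' free_star_algebra"
proof -
  interpret F: ring "free_star_algebra :: (E6_gen list \<Rightarrow>\<^sub>0 complex) star_algebra"
    by (rule ring_free_star_algebra)
  show ?thesis unfolding E6_ideal_def by (rule F.genideal_ideal) simp
qed

lemma E6_relators_subset: "E6_relators' \<subseteq> E6_ideal'"
proof -
  interpret F: ring "free_star_algebra :: (E6_gen list \<Rightarrow>\<^sub>0 complex) star_algebra"
    by (rule ring_free_star_algebra)
  show ?thesis unfolding E6_ideal_def by (rule F.genideal_self) simp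
qed

lemma free_star_generator: "free_star (generator x) = generator x"
  by (simp add: generator_def)

lemma free_star_E6_ideal:
  assumes "f \<in> E6_ideal'" shows "free_star f \<in> E6_ideal'"
proof -
  have comm: "generator x * Poly_Mapping.single [] c = Poly_Mapping.single [] c * generator x"
    for x :: E6_gen and c by (rule single_Nil_mult_commute[symmetric])
  have "free_star r \<in> E6_relators'" if "r \<in> E6_relators'" for r
    using that unfolding E6_relators_def Let_def
    by (elim UnE CollectE exE conjE insertE emptyE)
      (simp_all add: free_star_diff free_star_add free_star_mult free_star_generator comm, blast)
  then show ?thesis
    using assms E6_relators_subset free_star_genideal unfolding E6_ideal_def by blast
qed

lemmas E6_algebra_simps =
  quotient_star_algebra_simps[OF ideal_E6 free_star_E6_ideal, folded E6_algebra_def]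

text \<open>
  A representation is determined by its values on the generators.
\<close>

lemma star_representation_coset:
  assumes "star_representation E6_algebra' \<pi>"
  shows "\<pi> (cls f) = eval_matrix (\<lambda>x. \<pi> (E6_elem' x)) f"
proof -
  have cls: "cls f \<in> carrier E6_algebra'" for f
    by (simp add: E6_algebra_simps(1))
  note rep = assms[unfolded star_representation_def]
  have "\<pi> (cls x \<oplus>\<^bsub>E6_algebra'\<^esub> cls y) = \<pi> (cls x) + \<pi> (cls y)"
    "\<pi> (cls x \<otimes>\<^bsub>E6_algebra'\<^esub> cls y) = \<pi> (cls x) ** \<pi> (cls y)"
    "\<pi> (c \<odot>\<^bsub>E6_algebra'\<^esub> cls x) = mat c ** \<pi> (cls x)" for x y c
    using rep cls[of x] cls[of y] by auto
  then have \<pi>: "\<pi> (cls (x + y)) = \<pi> (cls x) + \<pi> (cls y)"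
    "\<pi> (cls (x * y)) = \<pi> (cls x) ** \<pi> (cls y)"
    "\<pi> (cls (Poly_Mapping.single [] c * x)) = mat c ** \<pi> (cls x)" for x y c
    by (simp_all only: E6_algebra_simps(3-5))
  have \<pi>1: "\<pi> (cls 1) = mat 1"
    using rep by (simp add: E6_algebra_simps(2))
  show ?thesis
  proof (induction f rule: poly_mapping_single_add_induct)
    case (single w c)
    have "\<pi> (cls (Poly_Mapping.single w 1)) = word_matrix (\<lambda>x. \<pi> (E6_elem' x)) w"
    proof (induction w)
      case Nil
      have "Poly_Mapping.single [] 1 = (1 :: E6_gen list \<Rightarrow>\<^sub>0 complex)"
        unfolding Poly_Mapping.single_one[symmetric] by (simp add: zero_list_def)
      then show ?case by (simp add: \<pi>1)
    next
      case (Cons x w)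
      have "Poly_Mapping.single (x # w) (1::complex) = generator x * Poly_Mapping.single w 1"
        by (simp add: generator_def mult_single plus_list_def)
      then show ?case using Cons by (simp add: \<pi> E6_elem_def)
    qed
    moreover have "Poly_Mapping.single w c = Poly_Mapping.single [] c * Poly_Mapping.single w 1"
      by (simp add: mult_single plus_list_def)
    ultimately show ?case by (metis \<pi>(3) eval_matrix_single)
  qed (simp add: \<pi> eval_matrix_add)
qed

lemma eval_matrix_E6_relators:
  "(\<forall>r\<in>E6_relators'. eval_matrix M r = 0) \<longleftrightarrow>
    (\<forall>x. M x ** M x = M x) \<and>
    M P1 ** M P2 = 0 \<and> M P2 ** M P1 = 0 \<and> M Q1 ** M Q2 = 0 \<and> M Q2 ** M Q1 = 0 \<and>
    M S1 ** M S2 = 0 \<and> M S2 ** M S1 = 0 \<and>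
    mat (of_real \<alpha>1) ** M P1 + mat (of_real \<alpha>2) ** M P2 + mat (of_real \<beta>1) ** M Q1
      + mat (of_real \<beta>2) ** M Q2 + mat (of_real \<delta>1) ** M S1 + mat (of_real \<delta>2) ** M S2
      = mat (of_real \<gamma>)"
proof -
  have "(\<forall>r. (\<exists>x. r = generator x * generator x - generator x \<and> True) \<longrightarrow> eval_matrix M r = 0)
    \<longleftrightarrow> (\<forall>x. eval_matrix M (generator x * generator x - generator x) = 0)"
    by blast
  then show ?thesis
    unfolding E6_relators_def Let_def ball_Un ball_simps free_star_algebra_simps
      eval_matrix_diff eval_matrix_add eval_matrix_mult eval_matrix_generator
      eval_matrix_single eval_matrix_one word_matrix.simps matrix_mul_rid right_minus_eq
    by (simp only: simp_thms conj_assoc)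
qed

lemma star_representation_E6_relations:
  assumes "star_representation E6_algebra' \<pi>"
  shows "E6_relations (\<lambda>x. \<pi> (E6_elem' x))"
proof -
  let ?M = "\<lambda>x. \<pi> (E6_elem' x)"
  have "eval_matrix ?M r = 0" if "r \<in> E6_ideal'" for r
  proof -
    have "cls r = cls 0" using that by (simp add: coset_eq_iff[OF ideal_E6])
    then have "eval_matrix ?M r = eval_matrix ?M 0"
      using star_representation_coset[OF assms, of r] star_representation_coset[OF assms, of 0]
      by simp
    then show ?thesis by (simp add: eval_matrix_def)
  qed
  then have "\<forall>r\<in>E6_relators'. eval_matrix ?M r = 0"
    using E6_relators_subset by blast
  moreover have "adjoint_matrix (?M x) = ?M x" for x
  proof -
    have "E6_elem' x \<in> carrier E6_algebra'"
      by (simp add: E6_algebra_simps(1) E6_elem_def)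
    then have "\<pi> (star E6_algebra' (E6_elem' x)) = adjoint_matrix (?M x)"
      using assms unfolding star_representation_def by blast
    then show ?thesis
      by (simp add: E6_algebra_simps(6) E6_elem_def free_star_generator)
  qed
  ultimately show ?thesis
    unfolding eval_matrix_E6_relators E6_relations_def by blast
qed

text \<open>
  Evaluation kills the relators, hence the ideal, so its value on a coset may be computed from any
  representative.
\<close>

lemma E6_relations_star_representation:
  assumes "E6_relations M"
  obtains \<pi> where "star_representation E6_algebra' \<pi>" "\<And>x. \<pi> (E6_elem' x) = M x"
proof
  let ?\<pi> = "\<lambda>X. eval_matrix M (SOME f. f \<in> X)"
  have zero: "eval_matrix M r = 0" if "r \<in> E6_ideal'" for r
    using eval_matrix_genideal[of E6_relators' M r] eval_matrix_E6_relators[of M] that assms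
    unfolding E6_relations_def E6_ideal_def by blast
  have \<pi>: "?\<pi> (cls f) = eval_matrix M f" for f
  proof -
    have "f \<in> cls f"
      unfolding mem_coset_iff[OF ideal_E6]
      using additive_subgroup.zero_closed[OF ideal.axioms(1)[OF ideal_E6]] by simp
    then have "(SOME g. g \<in> cls f) - f \<in> E6_ideal'"
      using someI[of "\<lambda>g. g \<in> cls f" f] by (simp add: mem_coset_iff[OF ideal_E6])
    then show ?thesis using zero eval_matrix_diff[of M _ f] by fastforce
  qed
  show "?\<pi> (E6_elem' x) = M x" for x
    unfolding E6_elem_def \<pi> by (rule eval_matrix_generator)
  show "star_representation E6_algebra' ?\<pi>"
    using assms
    by (auto simp: star_representation_def E6_algebra_simps \<pi> eval_matrix_add eval_matrix_mult
        eval_matrix_one eval_matrix_single eval_matrix_star E6_relations_def)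
qed

lemma irreducible_representation_iff:
  assumes "star_representation E6_algebra' \<pi>"
  shows "irreducible_representation E6_algebra' \<pi> \<longleftrightarrow>
    (\<forall>W. common_invariant (\<lambda>x. \<pi> (E6_elem' x)) W \<longrightarrow> W = {0} \<or> W = UNIV)"
proof -
  have "(\<forall>X\<in>carrier E6_algebra'. \<forall>v\<in>W. \<pi> X *v v \<in> W) \<longleftrightarrow> (\<forall>x. \<forall>v\<in>W. \<pi> (E6_elem' x) *v v \<in> W)"
    if W: "vec.subspace W" for W
  proof
    assume "\<forall>x. \<forall>v\<in>W. \<pi> (E6_elem' x) *v v \<in> W"
    then have "common_invariant (\<lambda>x. \<pi> (E6_elem' x)) W"
      using W by (simp add: common_invariant_def)
    then show "\<forall>X\<in>carrier E6_algebra'. \<forall>v\<in>W. \<pi> X *v v \<in> W"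
      using common_invariant_eval_matrix
      by (auto simp: E6_algebra_simps star_representation_coset[OF assms])
  qed (auto simp: E6_algebra_simps E6_elem_def)
  then show ?thesis
    unfolding irreducible_representation_def common_invariant_def by blast
qed

text \<open>
  The universal property of the presentation: from here on only six matrices matter.
\<close>

theorem E6_representation_iff_matrices:
  "(\<exists>\<pi> :: _ \<Rightarrow> complex ^ 'n ^ 'n. star_representation E6_algebra' \<pi> \<and>
      irreducible_representation E6_algebra' \<pi> \<and>
      generalized_dimension \<alpha>1 \<alpha>2 \<beta>1 \<beta>2 \<delta>1 \<delta>2 \<gamma> \<pi> = ((1, 1), (1, 1), (1, 1), CARD('n))) \<longleftrightarrow>
    (\<exists>M :: _ \<Rightarrow> complex ^ 'n ^ 'n. E6_relations M \<and> (\<forall>x. rank (M x) = 1) \<and>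
      (\<forall>W. common_invariant M W \<longrightarrow> W = {0} \<or> W = UNIV))"
  (is "?L \<longleftrightarrow> ?R")
proof -
  have dim: "generalized_dimension \<alpha>1 \<alpha>2 \<beta>1 \<beta>2 \<delta>1 \<delta>2 \<gamma> \<pi> = ((1, 1), (1, 1), (1, 1), CARD('n))
    \<longleftrightarrow> (\<forall>x. rank (\<pi> (E6_elem' x)) = 1)" for \<pi> :: "_ \<Rightarrow> complex ^ 'n ^ 'n"
  proof -
    have "(\<forall>x. P x) \<longleftrightarrow> P P1 \<and> P P2 \<and> P Q1 \<and> P Q2 \<and> P S1 \<and> P S2" for P
      by (metis E6_gen.exhaust)
    then show ?thesis by (simp add: generalized_dimension_def Let_def)
  qed
  show ?thesis
  proof
    assume ?L
    then show ?R
      using star_representation_E6_relations irreducible_representation_iff dim by blast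
  next
    assume ?R
    then obtain M :: "_ \<Rightarrow> complex ^ 'n ^ 'n" where M: "E6_relations M" "\<forall>x. rank (M x) = 1"
      "\<forall>W. common_invariant M W \<longrightarrow> W = {0} \<or> W = UNIV" by blast
    obtain \<pi> where \<pi>: "star_representation E6_algebra' \<pi>" "\<And>x. \<pi> (E6_elem' x) = M x"
      using E6_relations_star_representation[OF M(1)] by blast
    then have "(\<lambda>x. \<pi> (E6_elem' x)) = M" by auto
    then show ?L
      using M \<pi> irreducible_representation_iff[OF \<pi>(1)] dim by metis
  qed
qed

end

section \<open>Rank-one projections in Hermitian space\<close>

definition hinner :: "complex ^ 'n \<Rightarrow> complex ^ 'n \<Rightarrow> complex" where
  "hinner x y = (\<Sum>i\<in>UNIV. cnj (x $ i) * y $ i)"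

text \<open>
  For a unit vector this is the orthogonal projection onto its span.
\<close>

definition proj :: "complex ^ 'n \<Rightarrow> complex ^ 'n ^ 'n" where
  "proj n = (\<chi> i j. n $ i * cnj (n $ j))"

lemma hinner_self: "hinner x x = of_real ((norm x)\<^sup>2)"
proof -
  have "(norm x)\<^sup>2 = (\<Sum>i\<in>UNIV. (norm (x $ i))\<^sup>2)"
    by (simp add: norm_vec_def L2_set_def sum_nonneg)
  then show ?thesis
    by (simp only: hinner_def of_real_sum complex_norm_square mult.commute)
qed

lemma hinner_commute: "hinner y x = cnj (hinner x y)"
  by (simp add: hinner_def cnj_sum mult.commute)

lemma hinner_add_right: "hinner x (y + z) = hinner x y + hinner x z"
  by (simp add: hinner_def algebra_simps sum.distrib)

lemma hinner_scale_right: "hinner x (c *s y) = c * hinner x y"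
  by (simp add: hinner_def sum_distrib_left algebra_simps)

lemma hinner_scale_left: "hinner (c *s x) y = cnj c * hinner x y"
  by (simp add: hinner_def sum_distrib_left algebra_simps)

lemma hinner_zero [simp]: "hinner x 0 = 0" "hinner 0 x = 0"
  by (simp_all add: hinner_def)

lemma hinner_adjoint: "hinner x (A *v y) = hinner (adjoint_matrix A *v x) y"
proof -
  have "hinner x (A *v y) = (\<Sum>i\<in>UNIV. \<Sum>j\<in>UNIV. cnj (x $ i) * A $ i $ j * y $ j)"
    by (simp add: hinner_def matrix_vector_mult_def sum_distrib_left mult.assoc)
  also have "\<dots> = (\<Sum>j\<in>UNIV. \<Sum>i\<in>UNIV. cnj (x $ i) * A $ i $ j * y $ j)"
    by (rule sum.swap)
  also have "\<dots> = hinner (adjoint_matrix A *v x) y"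
    by (simp add: hinner_def matrix_vector_mult_def adjoint_matrix_def cnj_sum sum_distrib_left
        mult_ac)
  finally show ?thesis .
qed

lemma proj_mult: "proj n *v x = hinner n x *s n"
  by (simp add: proj_def hinner_def matrix_vector_mult_def vec_eq_iff sum_distrib_left mult_ac)

lemma adjoint_proj: "adjoint_matrix (proj n) = proj n"
  by (simp add: adjoint_matrix_def proj_def vec_eq_iff)

lemma proj_idem:
  assumes "hinner n n = 1" shows "proj n ** proj n = proj n"
  using assms by (simp add: matrix_eq matrix_vector_mul_assoc[symmetric] proj_mult hinner_scale_right)

lemma proj_orthogonal:
  assumes "hinner n k = 0" shows "proj n ** proj k = 0"
  using assms by (simp add: matrix_eq matrix_vector_mul_assoc[symmetric] proj_mult hinner_scale_right)

lemma rank_proj: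
  assumes "hinner n n = 1" shows "rank (proj n) = 1"
proof -
  let ?c = "\<chi> j. cnj (n $ j)"
  have row: "row i (proj n) = n $ i *s ?c" for i
    by (simp add: row_def proj_def vec_eq_iff)
  have "n \<noteq> 0" using assms by auto
  then obtain i where i: "n $ i \<noteq> 0" by (auto simp: vec_eq_iff)
  have c0: "?c \<noteq> 0" using i by (auto simp: vec_eq_iff)
  have "?c = inverse (n $ i) *s row i (proj n)" using i by (simp add: row)
  moreover have "row i (proj n) \<in> rows (proj n)" by (auto simp: rows_def)
  ultimately have "?c \<in> vec.span (rows (proj n))"
    by (metis vec.span_base vec.span_scale)
  then have "vec.span {?c} \<subseteq> vec.span (rows (proj n))"
    by (simp add: vec.span_minimal)
  moreover have "rows (proj n) \<subseteq> vec.span {?c}"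
    by (auto simp: rows_def row intro: vec.span_scale vec.span_base)
  ultimately have "vec.dim (rows (proj n)) = vec.dim {?c}"
    by (metis vec.span_eq_dim vec.span_minimal vec.subspace_span subset_antisym)
  also have "\<dots> = 1"
    using c0 vec.dim_eq_card_independent[of "{?c}"] by (simp add: vec.dependent_single)
  finally show ?thesis by (simp add: row_rank_def_gen)
qed

lemma ex_hinner_unit_multiple:
  assumes "x \<noteq> 0" obtains c where "c \<noteq> 0" "hinner (c *s x) (c *s x) = 1"
proof
  show "complex_of_real (1 / norm x) \<noteq> 0" using assms by simp
  show "hinner (complex_of_real (1 / norm x) *s x) (complex_of_real (1 / norm x) *s x) = 1"
    unfolding hinner_scale_right hinner_scale_left unfolding hinner_self
    using assms by (simp add: power2_eq_square)
qed

text \<open>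
  A nonzero vector in the one-dimensional range, normalised to length 1, serves as \<open>n\<close>. The
  coefficient of a value \<open>P y\<close> along \<open>n\<close> is found by moving the Hermitian \<open>P\<close> to the other side of
  the inner product.
\<close>

lemma rank_one_projection:
  fixes P :: "complex ^ 'n ^ 'n"
  assumes herm: "adjoint_matrix P = P" and idem: "P ** P = P" and rank: "rank P = 1"
  obtains n where "hinner n n = 1" "P = proj n"
proof -
  obtain B where B: "B \<subseteq> rows P" "vec.independent B" "rows P \<subseteq> vec.span B" "card B = vec.dim (rows P)"
    using vec.basis_exists by blast
  then have "card B = 1" using rank by (simp add: row_rank_def_gen)
  then obtain r where r: "B = {r}" by (metis card_1_singletonE)
  have "\<exists>c. row i P = c *s r" for i
    using B(3) unfolding r vec.span_singleton by (auto simp: rows_def)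
  then obtain c where c: "\<And>i. row i P = c i *s r" by metis
  have P: "P *v x = (\<Sum>j\<in>UNIV. r $ j * x $ j) *s (\<chi> i. c i)" for x
    using c by (simp add: matrix_vector_mult_def row_def vec_eq_iff sum_distrib_left mult_ac)
  have "r \<noteq> 0" using B(2) unfolding r by (metis vec.dependent_single)
  moreover have "r \<in> rows P" using B(1) r by blast
  ultimately have "P \<noteq> 0"
    by (intro notI) (auto simp: rows_def row_def zero_vec_def)
  then obtain x where x: "P *v x \<noteq> 0" by (auto simp: matrix_eq)
  obtain d where d: "d \<noteq> 0" "hinner (d *s (P *v x)) (d *s (P *v x)) = 1"
    using ex_hinner_unit_multiple[OF x] by blast
  define n where "n = d *s (P *v x)"
  have n: "P *v n = n" "hinner n n = 1"
    using idem d by (simp_all add: n_def vec.scale matrix_vector_mul_assoc)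
  have "P *v y = hinner n y *s n" for y
  proof -
    have "\<exists>e. P *v y = e *s n"
    proof -
      let ?s = "\<lambda>x. \<Sum>j\<in>UNIV. r $ j * x $ j"
      have "?s x \<noteq> 0" using x by (auto simp: P)
      then have "P *v y = (?s y / (?s x * d)) *s n"
        using d(1) by (simp add: n_def P vec_eq_iff)
      then show ?thesis ..
    qed
    then obtain e where e: "P *v y = e *s n" by blast
    then have "hinner n (P *v y) = e" by (simp add: hinner_scale_right n)
    then show ?thesis using e hinner_adjoint[of n P y] herm n(1) by simp
  qed
  then have "P = proj n" by (simp add: matrix_eq proj_mult)
  then show ?thesis using that n by blast
qed

text \<open>
  Two linear conditions in dimension three: a square matrix with a zero row has a kernel.
\<close>

lemma ex_hinner_orthogonal_pair:
  fixes x y :: "complex ^ 3"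
  obtains v where "v \<noteq> 0" "hinner x v = 0" "hinner y v = 0"
proof -
  define Q :: "complex ^ 3 ^ 3" where
    "Q = (\<chi> i. if i = 1 then (\<chi> j. cnj (x $ j)) else if i = 2 then (\<chi> j. cnj (y $ j)) else 0)"
  have "det Q = 0" by (simp add: det_3 Q_def)
  then have "\<not> (\<exists>B. B ** Q = mat 1)"
    by (metis invertible_det_nz invertible_left_inverse)
  then obtain v where v: "v \<noteq> 0" "Q *v v = 0"
    unfolding matrix_left_invertible_ker by blast
  have "hinner x v = (Q *v v) $ 1" "hinner y v = (Q *v v) $ 2"
    by (simp_all add: Q_def hinner_def matrix_vector_mult_def)
  then show ?thesis using that v by simp
qed

definition unitary_basis :: "(3 \<Rightarrow> complex ^ 3) \<Rightarrow> bool" where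
  "unitary_basis e \<longleftrightarrow> (\<forall>i j. hinner (e i) (e j) = (if i = j then 1 else 0))"

text \<open>
  Orthonormality is \<open>U U\<^sup>* = 1\<close>, the expansion is \<open>U\<^sup>* U = 1\<close>, and for square matrices one implies
  the other.
\<close>

lemma unitary_basis_expand:
  assumes "unitary_basis e"
  shows "v = (\<Sum>i\<in>UNIV. hinner (e i) v *s e i)"
proof -
  define U :: "complex ^ 3 ^ 3" where "U = (\<chi> i j. cnj (e i $ j))"
  have "U ** adjoint_matrix U = mat 1"
    using assms by (simp add: unitary_basis_def hinner_def U_def adjoint_matrix_def
        matrix_matrix_mult_def mat_def vec_eq_iff)
  then have "adjoint_matrix U ** U = mat 1" by (simp add: matrix_left_right_inverse)
  then have "v = adjoint_matrix U *v (U *v v)" by (simp add: matrix_vector_mul_assoc)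
  also have "\<dots> = (\<Sum>i\<in>UNIV. hinner (e i) v *s e i)"
    by (simp add: vec_eq_iff U_def adjoint_matrix_def matrix_vector_mult_def hinner_def mult.commute)
  finally show ?thesis .
qed

lemma hinner_sum_right: "hinner x (\<Sum>i\<in>S. f i) = (\<Sum>i\<in>S. hinner x (f i))"
  by (induction S rule: infinite_finite_induct) (simp_all add: hinner_add_right)

lemma unitary_basis_parseval:
  assumes "unitary_basis e"
  shows "(norm v)\<^sup>2 = (\<Sum>i\<in>UNIV. (cmod (hinner (e i) v))\<^sup>2)"
proof -
  have "complex_of_real ((norm v)\<^sup>2) = hinner v (\<Sum>i\<in>UNIV. hinner (e i) v *s e i)"
    unfolding unitary_basis_expand[OF assms, of v, symmetric] by (rule hinner_self[symmetric])
  also have "\<dots> = (\<Sum>i\<in>UNIV. hinner (e i) v * cnj (hinner (e i) v))"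
    by (simp add: hinner_sum_right hinner_scale_right hinner_commute[of v])
  also have "\<dots> = of_real (\<Sum>i\<in>UNIV. (cmod (hinner (e i) v))\<^sup>2)"
    by (simp only: of_real_sum complex_norm_square)
  finally show ?thesis by (simp only: of_real_eq_iff)
qed

lemma proj_pair_extends_to_basis:
  fixes n k :: "complex ^ 3"
  assumes "hinner n n = 1" "hinner k k = 1" "proj n ** proj k = 0"
  obtains e where "unitary_basis e" "e 1 = n" "e 2 = k"
proof -
  have "(proj n ** proj k) *v k = hinner n k *s n"
    using assms(2) by (simp add: matrix_vector_mul_assoc[symmetric] proj_mult)
  then have "hinner n k *s n = 0"
    unfolding assms(3) by (metis matrix_vector_mult_0)
  moreover have "n \<noteq> 0" using assms(1) by auto
  ultimately have nk: "hinner n k = 0" "hinner k n = 0" by (simp_all add: hinner_commute[of k n])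
  obtain v where v: "v \<noteq> 0" "hinner n v = 0" "hinner k v = 0"
    by (rule ex_hinner_orthogonal_pair)
  then have v': "hinner v n = 0" "hinner v k = 0"
    by (simp_all add: hinner_commute[of v n] hinner_commute[of v k])
  obtain c where "hinner (c *s v) (c *s v) = 1"
    using ex_hinner_unit_multiple[OF v(1)] by blast
  then have "unitary_basis (\<lambda>i. if i = 1 then n else if i = 2 then k else c *s v)"
    unfolding unitary_basis_def forall_3 using assms nk v v'
    by (simp add: hinner_scale_right hinner_scale_left)
  then show ?thesis using that by fastforce
qed

section \<open>Necessity: strict Weyl inequalities\<close>

text \<open>
  The weights \<open>\<bar>\<langle>e i, v\<rangle>\<bar>\<^sup>2\<close> add up to \<open>\<bar>v\<bar>\<^sup>2\<close>. If those with \<open>a i \<ge> a i0\<close> vanish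
  apart from the one at \<open>i0\<close>, the weighted average of the eigenvalues is at most \<open>a i0\<close>, with
  equality only if all the weight sits at \<open>i0\<close>.
\<close>

lemma spectral_sum_le:
  assumes e: "unitary_basis e"
    and gap: "\<And>i. i \<noteq> i0 \<Longrightarrow> a i < a i0 \<or> hinner (e i) v = 0"
  shows "(\<Sum>i\<in>UNIV. a i * (cmod (hinner (e i) v))\<^sup>2) \<le> a i0 * (norm v)\<^sup>2"
    and "(\<Sum>i\<in>UNIV. a i * (cmod (hinner (e i) v))\<^sup>2) = a i0 * (norm v)\<^sup>2 \<Longrightarrow> i \<noteq> i0 \<Longrightarrow> hinner (e i) v = 0"
proof -
  let ?d = "\<lambda>i. (a i0 - a i) * (cmod (hinner (e i) v))\<^sup>2"
  have d: "0 \<le> ?d i" for i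
    using gap[of i] by (cases "i = i0") auto
  have s: "(\<Sum>i\<in>UNIV. ?d i) = a i0 * (norm v)\<^sup>2 - (\<Sum>i\<in>UNIV. a i * (cmod (hinner (e i) v))\<^sup>2)"
    by (simp add: unitary_basis_parseval[OF e, of v] left_diff_distrib sum_subtractf sum_distrib_left)
  then show "(\<Sum>i\<in>UNIV. a i * (cmod (hinner (e i) v))\<^sup>2) \<le> a i0 * (norm v)\<^sup>2"
    using sum_nonneg[of UNIV ?d] d by simp
  assume "(\<Sum>i\<in>UNIV. a i * (cmod (hinner (e i) v))\<^sup>2) = a i0 * (norm v)\<^sup>2" "i \<noteq> i0"
  then have "?d i = 0" using s sum_nonneg_0[of UNIV ?d i] d by simp
  then show "hinner (e i) v = 0" using gap[OF \<open>i \<noteq> i0\<close>] by auto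
qed

lemma proj_common_eigenvector:
  assumes "unitary_basis e" "\<And>i. i \<noteq> i0 \<Longrightarrow> hinner (e i) v = 0"
  shows "proj (e i) *v v = (if i = i0 then v else 0)"
proof -
  have "v = (\<Sum>i\<in>UNIV. hinner (e i) v *s e i)"
    by (rule unitary_basis_expand[OF assms(1)])
  also have "\<dots> = (\<Sum>i\<in>UNIV. if i = i0 then hinner (e i0) v *s e i0 else 0)"
    by (rule sum.cong) (auto simp: assms(2))
  also have "\<dots> = hinner (e i0) v *s e i0" by simp
  finally have v: "hinner (e i0) v *s e i0 = v" by (rule sym)
  show ?thesis
  proof (cases "i = i0")
    case True
    then show ?thesis using v by (simp add: proj_mult)
  qed (simp add: proj_mult assms(2))
qed

text \<open>
  The vectors \<open>x\<close> and \<open>y\<close> are the eigenvectors that have to be avoided, those whose eigenvalues are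
  not below the chosen ones. A nonzero vector orthogonal to both has components only along the
  chosen eigenvectors and along eigenvectors with smaller eigenvalues.
\<close>

lemma weyl_strict:
  fixes a b c :: "3 \<Rightarrow> real"
  assumes e: "unitary_basis e" and f: "unitary_basis f" and g: "unitary_basis g"
    and total: "\<And>v. (\<Sum>i\<in>UNIV. a i * (cmod (hinner (e i) v))\<^sup>2) + (\<Sum>i\<in>UNIV. b i * (cmod (hinner (f i) v))\<^sup>2)
        + (\<Sum>i\<in>UNIV. c i * (cmod (hinner (g i) v))\<^sup>2) = \<gamma> * (norm v)\<^sup>2"
    and irr: "\<And>v i0 j0 k0. v \<noteq> 0 \<Longrightarrow> (\<And>i. proj (e i) *v v = (if i = i0 then v else 0)) \<Longrightarrow>
        (\<And>i. proj (f i) *v v = (if i = j0 then v else 0)) \<Longrightarrow>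
        (\<And>i. proj (g i) *v v = (if i = k0 then v else 0)) \<Longrightarrow> False"
    and gap: "\<And>i. i \<noteq> i0 \<Longrightarrow> a i < a i0 \<or> e i \<in> {x, y}" "\<And>i. i \<noteq> j0 \<Longrightarrow> b i < b j0 \<or> f i \<in> {x, y}"
      "\<And>i. i \<noteq> k0 \<Longrightarrow> c i < c k0 \<or> g i \<in> {x, y}"
  shows "\<gamma> < a i0 + b j0 + c k0"
proof (rule ccontr)
  assume "\<not> ?thesis"
  then have le: "a i0 + b j0 + c k0 \<le> \<gamma>" by simp
  obtain v where v: "v \<noteq> 0" "hinner x v = 0" "hinner y v = 0"
    by (rule ex_hinner_orthogonal_pair)
  have ga: "\<And>i. i \<noteq> i0 \<Longrightarrow> a i < a i0 \<or> hinner (e i) v = 0"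
    and gb: "\<And>i. i \<noteq> j0 \<Longrightarrow> b i < b j0 \<or> hinner (f i) v = 0"
    and gc: "\<And>i. i \<noteq> k0 \<Longrightarrow> c i < c k0 \<or> hinner (g i) v = 0"
    using gap v by auto
  have "(a i0 + b j0 + c k0) * (norm v)\<^sup>2 \<le> \<gamma> * (norm v)\<^sup>2"
    by (rule mult_right_mono[OF le]) simp
  note sums = this total[of v] spectral_sum_le(1)[OF e ga] spectral_sum_le(1)[OF f gb]
    spectral_sum_le(1)[OF g gc] distrib_right[of "a i0 + b j0" "c k0" "(norm v)\<^sup>2"]
    distrib_right[of "a i0" "b j0" "(norm v)\<^sup>2"]
  have "(\<Sum>i\<in>UNIV. a i * (cmod (hinner (e i) v))\<^sup>2) = a i0 * (norm v)\<^sup>2"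
    "(\<Sum>i\<in>UNIV. b i * (cmod (hinner (f i) v))\<^sup>2) = b j0 * (norm v)\<^sup>2"
    "(\<Sum>i\<in>UNIV. c i * (cmod (hinner (g i) v))\<^sup>2) = c k0 * (norm v)\<^sup>2"
    using sums by linarith+
  then have orth: "\<And>i. i \<noteq> i0 \<Longrightarrow> hinner (e i) v = 0" "\<And>i. i \<noteq> j0 \<Longrightarrow> hinner (f i) v = 0"
    "\<And>i. i \<noteq> k0 \<Longrightarrow> hinner (g i) v = 0"
    using spectral_sum_le(2)[OF e ga] spectral_sum_le(2)[OF f gb] spectral_sum_le(2)[OF g gc]
    by blast+
  show False
    by (rule irr[OF v(1) proj_common_eigenvector[OF e orth(1)] proj_common_eigenvector[OF f orth(2)]
          proj_common_eigenvector[OF g orth(3)]])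
qed

lemma hinner_proj: "hinner v (proj n *v v) = of_real ((cmod (hinner n v))\<^sup>2)"
  unfolding complex_norm_square by (simp add: proj_mult hinner_scale_right hinner_commute[of v n])

text \<open>
  The third eigenvector of each matrix has eigenvalue 0. The lower bounds on \<open>\<gamma>\<close> come from the
  negated matrices, for which the order of the eigenvalues is reversed.
\<close>

lemma irreducible_imp_strict_horn:
  fixes M :: "E6_gen \<Rightarrow> complex ^ 3 ^ 3"
  assumes rel: "E6_relations \<alpha>1 \<alpha>2 \<beta>1 \<beta>2 \<delta>1 \<delta>2 \<gamma> M" and rank: "\<And>x. rank (M x) = 1"
    and irr: "\<forall>W. common_invariant M W \<longrightarrow> W = {0} \<or> W = UNIV"
    and pos: "\<alpha>1 > \<alpha>2" "\<alpha>2 > 0" "\<beta>1 > \<beta>2" "\<beta>2 > 0" "\<delta>1 > \<delta>2" "\<delta>2 > 0"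
  shows "\<gamma> < \<alpha>1 + \<beta>1" "\<gamma> < \<alpha>1 + \<delta>1" "\<gamma> < \<beta>1 + \<delta>1"
    "\<gamma> < \<alpha>1 + \<beta>2 + \<delta>2" "\<gamma> < \<alpha>2 + \<beta>1 + \<delta>2" "\<gamma> < \<alpha>2 + \<beta>2 + \<delta>1"
    "\<alpha>1 < \<gamma>" "\<beta>1 < \<gamma>" "\<delta>1 < \<gamma>" "\<alpha>2 + \<beta>2 < \<gamma>" "\<alpha>2 + \<delta>2 < \<gamma>" "\<beta>2 + \<delta>2 < \<gamma>"
proof -
  note rel' = rel[unfolded E6_relations_def]
  have arm: "\<exists>e. unitary_basis e \<and> M x = proj (e 1) \<and> M y = proj (e 2)" if xy: "M x ** M y = 0" for x y
  proof -
    have *: "adjoint_matrix (M z) = M z" "M z ** M z = M z" for z using rel' by auto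
    obtain n where n: "hinner n n = 1" "M x = proj n"
      using rank_one_projection[OF *(1) *(2) rank] by metis
    obtain k where k: "hinner k k = 1" "M y = proj k"
      using rank_one_projection[OF *(1) *(2) rank] by metis
    show ?thesis
      using proj_pair_extends_to_basis[OF n(1) k(1)] xy n(2) k(2) by metis
  qed
  obtain e where e: "unitary_basis e" "M P1 = proj (e 1)" "M P2 = proj (e 2)"
    using arm[of P1 P2] rel' by auto
  obtain f where f: "unitary_basis f" "M Q1 = proj (f 1)" "M Q2 = proj (f 2)"
    using arm[of Q1 Q2] rel' by auto
  obtain g where g: "unitary_basis g" "M S1 = proj (g 1)" "M S2 = proj (g 2)"
    using arm[of S1 S2] rel' by auto
  define a b c :: "3 \<Rightarrow> real" where abc:
    "a = (\<lambda>i. if i = 1 then \<alpha>1 else if i = 2 then \<alpha>2 else 0)"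
    "b = (\<lambda>i. if i = 1 then \<beta>1 else if i = 2 then \<beta>2 else 0)"
    "c = (\<lambda>i. if i = 1 then \<delta>1 else if i = 2 then \<delta>2 else 0)"
  have total: "(\<Sum>i\<in>UNIV. a i * (cmod (hinner (e i) v))\<^sup>2) + (\<Sum>i\<in>UNIV. b i * (cmod (hinner (f i) v))\<^sup>2)
      + (\<Sum>i\<in>UNIV. c i * (cmod (hinner (g i) v))\<^sup>2) = \<gamma> * (norm v)\<^sup>2" for v
  proof -
    have "hinner v ((mat (of_real \<alpha>1) ** M P1 + mat (of_real \<alpha>2) ** M P2 + mat (of_real \<beta>1) ** M Q1
        + mat (of_real \<beta>2) ** M Q2 + mat (of_real \<delta>1) ** M S1 + mat (of_real \<delta>2) ** M S2) *v v)
        = hinner v (mat (of_real \<gamma>) *v v)"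
      using rel' by simp
    then have "of_real (\<alpha>1 * (cmod (hinner (e 1) v))\<^sup>2 + \<alpha>2 * (cmod (hinner (e 2) v))\<^sup>2
        + \<beta>1 * (cmod (hinner (f 1) v))\<^sup>2 + \<beta>2 * (cmod (hinner (f 2) v))\<^sup>2
        + \<delta>1 * (cmod (hinner (g 1) v))\<^sup>2 + \<delta>2 * (cmod (hinner (g 2) v))\<^sup>2)
        = complex_of_real (\<gamma> * (norm v)\<^sup>2)"
      unfolding e f g matrix_vector_mult_add_rdistrib matrix_vector_mul_assoc[symmetric] mat_vector_mult
        hinner_add_right hinner_scale_right hinner_proj hinner_self of_real_add of_real_mult .
    then show ?thesis unfolding of_real_eq_iff by (simp add: sum_3 abc)
  qed
  have no_eigenline: False
    if v: "v \<noteq> 0" "\<And>i. proj (e i) *v v = (if i = i0 then v else 0)"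
      "\<And>i. proj (f i) *v v = (if i = j0 then v else 0)" "\<And>i. proj (g i) *v v = (if i = k0 then v else 0)"
    for v i0 j0 k0
  proof -
    let ?W = "range (\<lambda>t. t *s v)"
    have "M x *v (t *s v) \<in> ?W" for x t
    proof -
      have "M x *v v = v \<or> M x *v v = 0"
        by (cases x) (simp_all add: e f g v(2-4))
      then have "M x *v (t *s v) = t *s v \<or> M x *v (t *s v) = 0 *s v"
        by (auto simp: vec.scale)
      then show ?thesis by blast
    qed
    then have "common_invariant M ?W"
      using vec.subspace_span[of "{v}"] unfolding common_invariant_def vec.span_singleton by auto
    moreover have "1 *s v \<in> ?W" by blast
    then have "?W \<noteq> {0}" using v(1) by auto
    ultimately have all: "?W = UNIV" using irr by blast
    obtain u where u: "u \<noteq> 0" "hinner v u = 0" by (rule ex_hinner_orthogonal_pair)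
    obtain t where "u = t *s v" using all by blast
    then show False using u v(1) by (simp add: hinner_scale_right hinner_self)
  qed
  have upper: "\<gamma> < a i0 + b j0 + c k0"
    if "\<forall>i. i \<noteq> i0 \<longrightarrow> a i < a i0 \<or> e i \<in> {x, y}" "\<forall>i. i \<noteq> j0 \<longrightarrow> b i < b j0 \<or> f i \<in> {x, y}"
      "\<forall>i. i \<noteq> k0 \<longrightarrow> c i < c k0 \<or> g i \<in> {x, y}" for i0 j0 k0 x y
    by (rule weyl_strict[OF e(1) f(1) g(1) total no_eigenline, where x = x and y = y])
      (assumption | use that in blast)+
  have neg: "(\<Sum>i\<in>UNIV. - a i * (cmod (hinner (e i) v))\<^sup>2) + (\<Sum>i\<in>UNIV. - b i * (cmod (hinner (f i) v))\<^sup>2)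
      + (\<Sum>i\<in>UNIV. - c i * (cmod (hinner (g i) v))\<^sup>2) = - \<gamma> * (norm v)\<^sup>2" for v
    using total[of v] by (simp add: sum_negf)
  have lower: "- \<gamma> < - a i0 + - b j0 + - c k0"
    if "\<forall>i. i \<noteq> i0 \<longrightarrow> a i0 < a i \<or> e i \<in> {x, y}" "\<forall>i. i \<noteq> j0 \<longrightarrow> b j0 < b i \<or> f i \<in> {x, y}"
      "\<forall>i. i \<noteq> k0 \<longrightarrow> c k0 < c i \<or> g i \<in> {x, y}" for i0 j0 k0 x y
    by (rule weyl_strict[OF e(1) f(1) g(1) neg no_eigenline, where x = x and y = y])
      (assumption | use that in \<open>simp; blast\<close>)+
  note simps = forall_3 abc
  \<comment> \<open>The vectors in the second and third arguments are the eigenvectors for the eigenvalues that lie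
    beyond the chosen ones.\<close>
  show "\<gamma> < \<alpha>1 + \<beta>1" using upper[of 1 "g 1" "g 2" 1 3] pos by (simp add: simps)
  show "\<gamma> < \<alpha>1 + \<delta>1" using upper[of 1 "f 1" "f 2" 3 1] pos by (simp add: simps)
  show "\<gamma> < \<beta>1 + \<delta>1" using upper[of 3 "e 1" "e 2" 1 1] pos by (simp add: simps)
  show "\<gamma> < \<alpha>1 + \<beta>2 + \<delta>2" using upper[of 1 "f 1" "g 1" 2 2] pos by (simp add: simps)
  show "\<gamma> < \<alpha>2 + \<beta>1 + \<delta>2" using upper[of 2 "e 1" "g 1" 1 2] pos by (simp add: simps)
  show "\<gamma> < \<alpha>2 + \<beta>2 + \<delta>1" using upper[of 2 "e 1" "f 1" 2 1] pos by (simp add: simps)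
  show "\<alpha>1 < \<gamma>" using lower[of 1 "e 2" "e 3" 3 3] pos by (simp add: simps)
  show "\<beta>1 < \<gamma>" using lower[of 3 "f 2" "f 3" 1 3] pos by (simp add: simps)
  show "\<delta>1 < \<gamma>" using lower[of 3 "g 2" "g 3" 3 1] pos by (simp add: simps)
  show "\<alpha>2 + \<beta>2 < \<gamma>" using lower[of 2 "e 3" "f 3" 2 3] pos by (simp add: simps)
  show "\<alpha>2 + \<delta>2 < \<gamma>" using lower[of 2 "e 3" "g 3" 3 2] pos by (simp add: simps)
  show "\<beta>2 + \<delta>2 < \<gamma>" using lower[of 3 "f 3" "g 3" 2 2] pos by (simp add: simps)
qed

section \<open>Cofactors and singular bases of real 3 by 3 matrices\<close>

text \<open>
  The cofactor matrix is the action of \<open>g\<close> on oriented areas, and so on normal vectors of planes.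
  This form, unlike \<open>det g\<close> times the inverse transpose, is polynomial in \<open>g\<close>.
\<close>

definition cofactor :: "real ^ 3 ^ 3 \<Rightarrow> real ^ 3 \<Rightarrow> real ^ 3" where
  "cofactor g \<phi> = \<phi> $ 1 *\<^sub>R (column 2 g \<times> column 3 g) + \<phi> $ 2 *\<^sub>R (column 3 g \<times> column 1 g)
     + \<phi> $ 3 *\<^sub>R (column 1 g \<times> column 2 g)"

lemmas coord3 = cross3_simps column_def matrix_vector_mult_def forall_3 cofactor_def

lemma cross_matrix_vector_mult: "(g *v x) \<times> (g *v y) = cofactor g (x \<times> y)"
  by (simp add: coord3)

lemma inner_cofactor: "(g *v x) \<bullet> cofactor g \<phi> = det g * (x \<bullet> \<phi>)"
  by (simp add: coord3)

lemma cofactor_add: "cofactor g (x + y) = cofactor g x + cofactor g y"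
  and cofactor_scaleR: "cofactor g (c *\<^sub>R x) = c *\<^sub>R cofactor g x"
  by (simp_all add: cofactor_def scaleR_add_left scaleR_add_right add_ac)

lemma cofactor_scale_matrix: "cofactor (c *\<^sub>R g) \<phi> = c\<^sup>2 *\<^sub>R cofactor g \<phi>"
  by (simp add: coord3 power2_eq_square)

lemma det_scale_matrix: "det (c *\<^sub>R g) = c ^ 3 * det g" for g :: "real ^ 3 ^ 3"
  by (simp add: det_3 power3_eq_cube algebra_simps)

lemma cofactor_eq_0_iff:
  assumes "det g \<noteq> 0" shows "cofactor g \<phi> = 0 \<longleftrightarrow> \<phi> = 0"
proof
  assume "cofactor g \<phi> = 0"
  then have "det g * (\<phi> \<bullet> \<phi>) = 0" using inner_cofactor[of g \<phi> \<phi>] by simp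
  then show "\<phi> = 0" using assms by simp
qed (simp add: cofactor_def)

lemma mult_eq_0_iff_det:
  assumes "det g \<noteq> 0" shows "g *v x = 0 \<longleftrightarrow> x = (0 :: real ^ 3)"
  using assms by (metis invertible_det_nz matrix_vector_mult_0_right invertible_def matrix_left_invertible_ker)

text \<open>
  A right-handed orthonormal basis of right singular vectors, in increasing order of the singular
  values \<open>norm (g *v e1)\<close>, \<open>norm (g *v e2)\<close>, \<open>norm (g *v e3)\<close>.
\<close>

definition singular_basis :: "real ^ 3 ^ 3 \<Rightarrow> real ^ 3 \<Rightarrow> real ^ 3 \<Rightarrow> real ^ 3 \<Rightarrow> bool" where
  "singular_basis g e1 e2 e3 \<longleftrightarrow>
     e1 \<bullet> e1 = 1 \<and> e2 \<bullet> e2 = 1 \<and> e3 \<bullet> e3 = 1 \<and> e1 \<bullet> e2 = 0 \<and> e1 \<bullet> e3 = 0 \<and> e2 \<bullet> e3 = 0 \<and>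
     e1 \<times> e2 = e3 \<and> e2 \<times> e3 = e1 \<and> e3 \<times> e1 = e2 \<and>
     (g *v e1) \<bullet> (g *v e2) = 0 \<and> (g *v e1) \<bullet> (g *v e3) = 0 \<and> (g *v e2) \<bullet> (g *v e3) = 0 \<and>
     norm (g *v e1) \<le> norm (g *v e2) \<and> norm (g *v e2) \<le> norm (g *v e3)"

lemma nonneg_quadratic_linear_coeff:
  fixes b c :: real
  assumes "\<And>t. 0 \<le> t * b + t\<^sup>2 * c"
  shows "b = 0"
proof (rule ccontr)
  assume b: "b \<noteq> 0"
  \<comment> \<open>At \<open>t = - b / d\<close> the linear term dominates the quadratic one as soon as \<open>d > \<bar>c\<bar>\<close>.\<close>
  define d where "d = \<bar>c\<bar> + 1"
  have d: "d > 0" "c < d" by (auto simp: d_def)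
  have "0 \<le> (- b / d) * b + (- b / d)\<^sup>2 * c" using assms .
  also have "\<dots> = (b\<^sup>2 / d) * (c / d - 1)"
    using d by (simp add: power2_eq_square field_simps)
  also have "\<dots> < 0"
    using b d by (intro mult_pos_neg) (auto simp: field_simps)
  finally show False by simp
qed

text \<open>
  First-order condition at a direction of minimal stretch: the derivative in the direction of an
  orthogonal \<open>x\<close> vanishes.
\<close>

lemma minimal_stretch_orthogonal:
  fixes g :: "real ^ 'n ^ 'm"
  assumes e: "e \<bullet> e = 1" and x: "x \<bullet> e = 0"
    and min: "\<And>t. norm (g *v e) * norm (e + t *\<^sub>R x) \<le> norm (g *v (e + t *\<^sub>R x))"
  shows "(g *v e) \<bullet> (g *v x) = 0"
proof -
  let ?l = "(g *v e) \<bullet> (g *v e)"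
  have "0 \<le> t * (2 * ((g *v e) \<bullet> (g *v x))) + t\<^sup>2 * ((g *v x) \<bullet> (g *v x) - ?l * (x \<bullet> x))" for t
  proof -
    have "(norm (g *v e) * norm (e + t *\<^sub>R x))\<^sup>2 \<le> (norm (g *v (e + t *\<^sub>R x)))\<^sup>2"
      using min[of t] by (intro power_mono) auto
    then have "?l * ((e + t *\<^sub>R x) \<bullet> (e + t *\<^sub>R x)) \<le> (g *v (e + t *\<^sub>R x)) \<bullet> (g *v (e + t *\<^sub>R x))"
      by (simp add: power_mult_distrib power2_norm_eq_inner)
    then show ?thesis
      using e x
      by (simp add: matrix_vector_right_distrib matrix_vector_mult_scaleR inner_add_left inner_add_right
          inner_commute power2_eq_square algebra_simps)
  qed
  from nonneg_quadratic_linear_coeff[OF this] show ?thesis by simp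
qed

lemma ex_minimal_stretch:
  fixes g :: "real ^ 'n ^ 'm"
  assumes "subspace U" "x0 \<in> U" "x0 \<noteq> 0"
  obtains e where "e \<in> U" "e \<bullet> e = 1" "\<And>x. x \<in> U \<Longrightarrow> norm (g *v e) * norm x \<le> norm (g *v x)"
proof -
  let ?S = "U \<inter> sphere 0 1"
  have "compact ?S"
    using closed_subspace[OF assms(1)] by (simp add: closed_Int_compact)
  moreover have "inverse (norm x0) *\<^sub>R x0 \<in> ?S"
    using assms by (simp add: subspace_scale)
  moreover have "continuous_on ?S (\<lambda>x. norm (g *v x))"
    by (intro continuous_intros)
  ultimately obtain e where e: "e \<in> ?S" "\<And>x. x \<in> ?S \<Longrightarrow> norm (g *v e) \<le> norm (g *v x)"
    using continuous_attains_inf[of ?S "\<lambda>x. norm (g *v x)"] by blast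
  show ?thesis
  proof
    show "e \<in> U" "e \<bullet> e = 1" using e by (auto simp: dot_square_norm)
    fix x assume x: "x \<in> U"
    show "norm (g *v e) * norm x \<le> norm (g *v x)"
    proof (cases "x = 0")
      case False
      have "norm (g *v e) \<le> norm (g *v (inverse (norm x) *\<^sub>R x))"
        using x False assms(1) by (intro e) (simp add: subspace_scale)
      then show ?thesis
        using False by (simp add: matrix_vector_mult_scaleR field_simps)
    qed simp
  qed
qed

text \<open>
  The first vector is a direction of minimal stretch, the second one a direction of minimal
  stretch in its orthogonal complement, and the third one is their cross product.
\<close>

lemma ex_singular_basis:
  obtains e1 e2 e3 where "singular_basis g e1 e2 e3"
proof -
  obtain e1 where e1: "e1 \<bullet> e1 = 1" "\<And>x. norm (g *v e1) * norm x \<le> norm (g *v x)"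
    using ex_minimal_stretch[of UNIV "axis 1 1" g] by (auto simp: axis_eq_0_iff)
  let ?U = "{x. e1 \<bullet> x = 0}"
  have U: "subspace ?U" by (rule subspace_hyperplane)
  obtain x0 where x0: "x0 \<in> ?U" "x0 \<noteq> 0"
  proof -
    have "e1 \<times> axis 1 1 \<noteq> 0 \<or> e1 \<times> axis 2 1 \<noteq> 0"
    proof (rule ccontr)
      assume "\<not> ?thesis"
      then have "e1 = 0" by (simp add: cross3_simps forall_3 axis_def)
      then show False using e1(1) by simp
    qed
    then show ?thesis using that dot_cross_self(1)[of e1] by blast
  qed
  obtain e2 where e2: "e1 \<bullet> e2 = 0" "e2 \<bullet> e2 = 1"
    "\<And>x. e1 \<bullet> x = 0 \<Longrightarrow> norm (g *v e2) * norm x \<le> norm (g *v x)"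
    using ex_minimal_stretch[OF U x0, of g] by auto
  define e3 where "e3 = e1 \<times> e2"
  have e3: "e1 \<bullet> e3 = 0" "e2 \<bullet> e3 = 0"
    by (simp_all add: e3_def dot_cross_self)
  have n3: "e3 \<bullet> e3 = 1"
    using norm_cross_dot[of e1 e2] e1(1) e2(1,2)
    by (simp add: e3_def power_mult_distrib power2_norm_eq_inner)
  have c: "e2 \<times> e3 = e1" "e3 \<times> e1 = e2"
    using e1(1) e2(1,2) Lagrange[of e2 e1 e2] Lagrange[of e1 e1 e2] cross_skew[of e3 e1]
    by (simp_all add: e3_def inner_commute)
  have n: "norm e1 = 1" "norm e2 = 1" "norm e3 = 1"
    using e1(1) e2(2) n3 by (simp_all add: norm_eq_1)
  have o1: "(g *v e1) \<bullet> (g *v x) = 0" if "x \<bullet> e1 = 0" for x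
    by (rule minimal_stretch_orthogonal[OF e1(1) that e1(2)])
  have o2: "(g *v e2) \<bullet> (g *v e3) = 0"
    by (rule minimal_stretch_orthogonal[OF e2(2)])
      (use e2 e3 in \<open>auto simp: inner_commute inner_add_right\<close>)
  have "singular_basis g e1 e2 e3"
    unfolding singular_basis_def
    using e1 e2 e3 n3 c o1[of e2] o1[of e3] o2 n e1(2)[of e2] e2(3)[of e3]
    by (simp add: e3_def[symmetric] inner_commute)
  then show ?thesis by (rule that)
qed

lemma orthonormal_cross_expand:
  fixes e1 e2 :: "real ^ 3"
  assumes "e1 \<bullet> e1 = 1" "e2 \<bullet> e2 = 1" "e1 \<bullet> e2 = 0"
  shows "x = (e1 \<bullet> x) *\<^sub>R e1 + (e2 \<bullet> x) *\<^sub>R e2 + ((e1 \<times> e2) \<bullet> x) *\<^sub>R (e1 \<times> e2)"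
proof -
  define e3 where "e3 = e1 \<times> e2"
  have e3: "e3 \<bullet> e3 = 1" "e1 \<bullet> e3 = 0" "e2 \<bullet> e3 = 0"
    using norm_cross_dot[of e1 e2] assms
    by (simp_all add: e3_def dot_cross_self power_mult_distrib power2_norm_eq_inner)
  define d where "d = x - ((e1 \<bullet> x) *\<^sub>R e1 + (e2 \<bullet> x) *\<^sub>R e2 + (e3 \<bullet> x) *\<^sub>R e3)"
  have d: "e1 \<bullet> d = 0" "e2 \<bullet> d = 0" "e3 \<bullet> d = 0"
    using assms e3 by (simp_all add: d_def inner_diff_right inner_add_right inner_commute)
  have "d \<times> e3 = 0"
    using Lagrange[of d e1 e2] d by (simp add: e3_def inner_commute)
  then have "e3 \<times> (d \<times> e3) = 0" by simp
  then have "d = 0"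
    using Lagrange[of e3 d e3] d(3) e3(1) by (simp add: inner_commute)
  then show ?thesis by (simp add: d_def e3_def)
qed

lemma orthonormal_cross_parseval:
  fixes e1 e2 :: "real ^ 3"
  assumes "e1 \<bullet> e1 = 1" "e2 \<bullet> e2 = 1" "e1 \<bullet> e2 = 0"
  shows "(norm x)\<^sup>2 = (e1 \<bullet> x)\<^sup>2 + (e2 \<bullet> x)\<^sup>2 + ((e1 \<times> e2) \<bullet> x)\<^sup>2"
proof -
  have "(norm x)\<^sup>2 = x \<bullet> ((e1 \<bullet> x) *\<^sub>R e1 + (e2 \<bullet> x) *\<^sub>R e2 + ((e1 \<times> e2) \<bullet> x) *\<^sub>R (e1 \<times> e2))"
    using orthonormal_cross_expand[OF assms, of x] by (simp add: power2_norm_eq_inner)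
  then show ?thesis by (simp add: inner_add_right inner_commute power2_eq_square)
qed

context
  fixes g e1 e2 e3 assumes sb: "singular_basis g e1 e2 e3"
begin

lemma singular_expand: "x = (e1 \<bullet> x) *\<^sub>R e1 + (e2 \<bullet> x) *\<^sub>R e2 + (e3 \<bullet> x) *\<^sub>R e3"
  and singular_parseval: "(norm x)\<^sup>2 = (e1 \<bullet> x)\<^sup>2 + (e2 \<bullet> x)\<^sup>2 + (e3 \<bullet> x)\<^sup>2"
  using orthonormal_cross_expand[of e1 e2 x] orthonormal_cross_parseval[of e1 e2 x] sb
  unfolding singular_basis_def by metis+

lemma norm_singular_mult:
  "(norm (g *v x))\<^sup>2 = (e1 \<bullet> x)\<^sup>2 * (norm (g *v e1))\<^sup>2 + (e2 \<bullet> x)\<^sup>2 * (norm (g *v e2))\<^sup>2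
     + (e3 \<bullet> x)\<^sup>2 * (norm (g *v e3))\<^sup>2"
proof -
  have "g *v x = (e1 \<bullet> x) *\<^sub>R (g *v e1) + (e2 \<bullet> x) *\<^sub>R (g *v e2) + (e3 \<bullet> x) *\<^sub>R (g *v e3)"
    by (subst singular_expand) (simp add: matrix_vector_right_distrib matrix_vector_mult_scaleR)
  then show ?thesis
    using sb unfolding singular_basis_def power2_norm_eq_inner
    by (simp add: inner_add_left inner_add_right inner_commute power2_eq_square)
qed

text \<open>
  On areas the singular values are the products of two singular values of \<open>g\<close>: the one along
  the normal \<open>e1\<close> is that of the plane of \<open>e2\<close> and \<open>e3\<close>.
\<close>

lemma norm_singular_cofactor:
  "(norm (cofactor g \<phi>))\<^sup>2 = (e1 \<bullet> \<phi>)\<^sup>2 * ((norm (g *v e2))\<^sup>2 * (norm (g *v e3))\<^sup>2)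
     + (e2 \<bullet> \<phi>)\<^sup>2 * ((norm (g *v e1))\<^sup>2 * (norm (g *v e3))\<^sup>2)
     + (e3 \<bullet> \<phi>)\<^sup>2 * ((norm (g *v e1))\<^sup>2 * (norm (g *v e2))\<^sup>2)"
proof -
  let ?a = "g *v e1" and ?b = "g *v e2" and ?c = "g *v e3"
  have o: "?a \<bullet> ?b = 0" "?a \<bullet> ?c = 0" "?b \<bullet> ?c = 0"
    using sb by (auto simp: singular_basis_def)
  have "cofactor g e1 = ?b \<times> ?c" "cofactor g e2 = ?c \<times> ?a" "cofactor g e3 = ?a \<times> ?b"
    using sb cross_matrix_vector_mult[of g] by (metis singular_basis_def)+
  then have "cofactor g \<phi> = (e1 \<bullet> \<phi>) *\<^sub>R (?b \<times> ?c) + (e2 \<bullet> \<phi>) *\<^sub>R (?c \<times> ?a) + (e3 \<bullet> \<phi>) *\<^sub>R (?a \<times> ?b)"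
    by (subst singular_expand) (simp add: cofactor_add cofactor_scaleR)
  moreover have "(x \<times> y) \<bullet> (z \<times> w) = (x \<bullet> z) * (y \<bullet> w) - (x \<bullet> w) * (y \<bullet> z)" for x y z w :: "real ^ 3"
    by (simp add: cross3_simps)
  ultimately show ?thesis
    using o unfolding power2_norm_eq_inner
    by (simp add: inner_add_left inner_add_right inner_commute power2_eq_square)
qed

lemma det_singular_le:
  "(det g)\<^sup>2 \<le> (norm (g *v e1))\<^sup>2 * (norm (g *v e2))\<^sup>2 * (norm (g *v e3))\<^sup>2"
proof -
  have "det g = (g *v e1) \<bullet> cofactor g e1"
    using inner_cofactor[of g e1 e1] sb by (simp add: singular_basis_def)
  then have "(det g)\<^sup>2 \<le> (norm (g *v e1))\<^sup>2 * (norm (cofactor g e1))\<^sup>2"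
    using Cauchy_Schwarz_ineq[of "g *v e1" "cofactor g e1"] by (simp add: power2_norm_eq_inner)
  also have "(norm (cofactor g e1))\<^sup>2 = (norm (g *v e2))\<^sup>2 * (norm (g *v e3))\<^sup>2"
    using norm_singular_cofactor[of e1] sb by (simp add: singular_basis_def inner_commute)
  finally show ?thesis by (simp add: mult.assoc)
qed

end

section \<open>Energy of a weighted triple of flags\<close>

lemma ln_ge_add:
  fixes x :: real
  assumes "x * A \<le> B" "0 < x" "0 < A"
  shows "ln x + ln A \<le> ln B"
proof -
  have "ln x + ln A = ln (x * A)" using assms by (simp add: ln_mult)
  also have "\<dots> \<le> ln B" using assms by (subst ln_le_cancel_iff) (auto intro: less_le_trans mult_pos_pos)
  finally show ?thesis .
qed

lemma singular_pos:
  assumes "singular_basis g e1 e2 e3" "det g \<noteq> 0"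
  shows "0 < (norm (g *v e1))\<^sup>2" "0 < (norm (g *v e2))\<^sup>2" "0 < (norm (g *v e3))\<^sup>2"
proof -
  have "e1 \<noteq> 0" "e2 \<noteq> 0" "e3 \<noteq> 0" using assms(1) by (auto simp: singular_basis_def)
  then show "0 < (norm (g *v e1))\<^sup>2" "0 < (norm (g *v e2))\<^sup>2" "0 < (norm (g *v e3))\<^sup>2"
    using mult_eq_0_iff_det[OF assms(2)] by auto
qed

text \<open>
  The length of the image of \<open>v\<close> grows at least like the largest singular value in whose direction
  \<open>v\<close> has a component that is not small. The form with indicators makes the bound linear in
  the gaps between consecutive logarithms.
\<close>

lemma line_growth:
  fixes v :: "real ^ 3"
  assumes sb: "singular_basis g e1 e2 e3" and g: "det g \<noteq> 0" and \<epsilon>: "0 < \<epsilon>"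
    and v: "\<epsilon> \<le> \<bar>e1 \<bullet> v\<bar> \<or> \<epsilon> \<le> \<bar>e2 \<bullet> v\<bar> \<or> \<epsilon> \<le> \<bar>e3 \<bullet> v\<bar>"
  defines "t1 \<equiv> ln ((norm (g *v e1))\<^sup>2)" and "t2 \<equiv> ln ((norm (g *v e2))\<^sup>2)"
    and "t3 \<equiv> ln ((norm (g *v e3))\<^sup>2)"
  shows "ln (\<epsilon>\<^sup>2) + t1 + (t2 - t1) * of_bool (\<epsilon> \<le> \<bar>e2 \<bullet> v\<bar> \<or> \<epsilon> \<le> \<bar>e3 \<bullet> v\<bar>)
      + (t3 - t2) * of_bool (\<epsilon> \<le> \<bar>e3 \<bullet> v\<bar>) \<le> ln ((norm (g *v v))\<^sup>2)"
proof -
  note pos = singular_pos[OF sb g]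
  have bound: "ln (\<epsilon>\<^sup>2) + ln A \<le> ln ((norm (g *v v))\<^sup>2)"
    if "\<epsilon> \<le> \<bar>x\<bar>" "0 < A" "x\<^sup>2 * A \<le> (norm (g *v v))\<^sup>2" for x A
  proof (rule ln_ge_add)
    have "\<epsilon>\<^sup>2 \<le> x\<^sup>2" using that(1) \<epsilon> by (simp add: abs_le_square_iff[symmetric])
    then show "\<epsilon>\<^sup>2 * A \<le> (norm (g *v v))\<^sup>2"
      using that(2,3) by (meson less_imp_le mult_right_mono order_trans)
  qed (use \<epsilon> that in auto)
  have "(e1 \<bullet> v)\<^sup>2 * (norm (g *v e1))\<^sup>2 \<le> (norm (g *v v))\<^sup>2"
    "(e2 \<bullet> v)\<^sup>2 * (norm (g *v e2))\<^sup>2 \<le> (norm (g *v v))\<^sup>2"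
    "(e3 \<bullet> v)\<^sup>2 * (norm (g *v e3))\<^sup>2 \<le> (norm (g *v v))\<^sup>2"
    by (simp_all add: norm_singular_mult[OF sb, of v])
  note b = bound[OF _ pos(1) this(1)] bound[OF _ pos(2) this(2)] bound[OF _ pos(3) this(3)]
  show ?thesis
    using v b unfolding t1_def t2_def t3_def by auto
qed

text \<open>
  The area of the image of a plane with normal \<open>\<phi>\<close> grows at least like the largest product of two
  singular values that occurs; the product of the two larger ones occurs as soon as \<open>\<phi>\<close> has a
  component along \<open>e1\<close> that is not small.
\<close>

lemma plane_growth:
  fixes \<phi> :: "real ^ 3"
  assumes sb: "singular_basis g e1 e2 e3" and g: "det g \<noteq> 0" and \<epsilon>: "0 < \<epsilon>"
    and \<phi>: "\<epsilon> \<le> \<bar>e1 \<bullet> \<phi>\<bar> \<or> \<epsilon> \<le> \<bar>e2 \<bullet> \<phi>\<bar> \<or> \<epsilon> \<le> \<bar>e3 \<bullet> \<phi>\<bar>"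
  defines "t1 \<equiv> ln ((norm (g *v e1))\<^sup>2)" and "t2 \<equiv> ln ((norm (g *v e2))\<^sup>2)"
    and "t3 \<equiv> ln ((norm (g *v e3))\<^sup>2)"
  shows "ln (\<epsilon>\<^sup>2) + 2 * t1 + (t2 - t1) * (1 + of_bool (\<epsilon> \<le> \<bar>e1 \<bullet> \<phi>\<bar>))
      + (t3 - t2) * of_bool (\<epsilon> \<le> \<bar>e1 \<bullet> \<phi>\<bar> \<or> \<epsilon> \<le> \<bar>e2 \<bullet> \<phi>\<bar>) \<le> ln ((norm (cofactor g \<phi>))\<^sup>2)"
proof -
  note pos = singular_pos[OF sb g]
  have bound: "ln (\<epsilon>\<^sup>2) + (ln A + ln B) \<le> ln ((norm (cofactor g \<phi>))\<^sup>2)"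
    if "\<epsilon> \<le> \<bar>x\<bar>" "0 < A" "0 < B" "x\<^sup>2 * (A * B) \<le> (norm (cofactor g \<phi>))\<^sup>2" for x A B
  proof -
    have "\<epsilon>\<^sup>2 \<le> x\<^sup>2" using that(1) \<epsilon> by (simp add: abs_le_square_iff[symmetric])
    then have "\<epsilon>\<^sup>2 * (A * B) \<le> (norm (cofactor g \<phi>))\<^sup>2"
      using that(2,3,4) by (meson less_imp_le mult_right_mono order_trans mult_pos_pos)
    then have "ln (\<epsilon>\<^sup>2) + ln (A * B) \<le> ln ((norm (cofactor g \<phi>))\<^sup>2)"
      using \<epsilon> that by (intro ln_ge_add) auto
    then show ?thesis using that(2,3) by (simp add: ln_mult)
  qed
  have "(e1 \<bullet> \<phi>)\<^sup>2 * ((norm (g *v e2))\<^sup>2 * (norm (g *v e3))\<^sup>2) \<le> (norm (cofactor g \<phi>))\<^sup>2"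
    "(e2 \<bullet> \<phi>)\<^sup>2 * ((norm (g *v e1))\<^sup>2 * (norm (g *v e3))\<^sup>2) \<le> (norm (cofactor g \<phi>))\<^sup>2"
    "(e3 \<bullet> \<phi>)\<^sup>2 * ((norm (g *v e1))\<^sup>2 * (norm (g *v e2))\<^sup>2) \<le> (norm (cofactor g \<phi>))\<^sup>2"
    by (simp_all add: norm_singular_cofactor[OF sb, of \<phi>])
  note b = bound[OF _ pos(2,3) this(1)] bound[OF _ pos(1,3) this(2)] bound[OF _ pos(1,2) this(3)]
  show ?thesis
    using \<phi> b unfolding t1_def t2_def t3_def by (auto simp: algebra_simps)
qed

lemma det_growth:
  assumes sb: "singular_basis g e1 e2 e3" and g: "det g \<noteq> 0"
  shows "ln ((det g)\<^sup>2) \<le> ln ((norm (g *v e1))\<^sup>2) + ln ((norm (g *v e2))\<^sup>2) + ln ((norm (g *v e3))\<^sup>2)"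
proof -
  note pos = singular_pos[OF sb g]
  have "ln ((det g)\<^sup>2) \<le> ln ((norm (g *v e1))\<^sup>2 * (norm (g *v e2))\<^sup>2 * (norm (g *v e3))\<^sup>2)"
    using det_singular_le[OF sb] g pos by (subst ln_le_cancel_iff) auto
  also have "\<dots> = ln ((norm (g *v e1))\<^sup>2) + ln ((norm (g *v e2))\<^sup>2) + ln ((norm (g *v e3))\<^sup>2)"
    using pos by (subst ln_mult | simp)+
  finally show ?thesis .
qed

text \<open>
  Flag \<open>i\<close> consists of the line spanned by the basis vector \<open>axis i 1\<close> and of the plane orthogonal to
  \<open>flag_normal i\<close>. General position means that no line lies in the plane of another flag and
  that neither the lines nor the normals are linearly dependent; this choice has that property.
\<close>

definition flag_normal :: "3 \<Rightarrow> real ^ 3" where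
  "flag_normal i = (\<chi> j. if j = i then 0 else 1)"

text \<open>
  Up to factors and additive constants, the first term is the logarithm of the length that \<open>g\<close> gives to
  the unit vector of line \<open>i\<close>, and the second one that of the area it gives to plane \<open>i\<close>. For the first flag
  the weights will be \<open>w = \<alpha>1 - \<alpha>2\<close> and \<open>u = \<alpha>2\<close>, because
  \<open>\<alpha>1 p1 + \<alpha>2 p2 = w p1 + u (p1 + p2)\<close>, where \<open>p1\<close> belongs to the line and \<open>p1 + p2\<close> to the plane.
\<close>

definition flag_energy :: "(3 \<Rightarrow> real) \<Rightarrow> (3 \<Rightarrow> real) \<Rightarrow> real \<Rightarrow> real ^ 3 ^ 3 \<Rightarrow> real" where
  "flag_energy w u \<gamma> g =
     (\<Sum>i\<in>UNIV. w i * ln ((norm (g *v axis i 1))\<^sup>2) + u i * ln ((norm (cofactor g (flag_normal i)))\<^sup>2))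
       - \<gamma> * ln ((det g)\<^sup>2)"

lemma flag_normal_nonzero: "flag_normal i \<noteq> 0"
  using exhaust_3[of i] by (auto simp: flag_normal_def vec_eq_iff forall_3)

lemma inner_flag_normal:
  "x \<bullet> flag_normal 1 = x $ 2 + x $ 3" "x \<bullet> flag_normal 2 = x $ 1 + x $ 3"
  "x \<bullet> flag_normal 3 = x $ 1 + x $ 2"
  by (simp_all add: flag_normal_def inner_vec_def sum_3)

lemma square_less_of_abs_less:
  fixes x y :: real
  assumes "\<bar>x\<bar> < y" shows "x\<^sup>2 < y\<^sup>2"
  using assms power_strict_mono[of "\<bar>x\<bar>" y 2] by simp

text \<open>
  Quantitative general position, seen from a unit vector \<open>(a, b, c)\<close>: it cannot be close to two
  lines of the flags, nor close to a line and to the plane of another flag, nor close to all three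
  planes. The thresholds match the tolerance 1/10 for a small component: a unit vector with two
  components below 1/10 has the square of the third one above 98/100.
\<close>

lemma flag_generic_line:
  fixes a b c :: real
  assumes "a\<^sup>2 + b\<^sup>2 + c\<^sup>2 = 1"
  shows "\<not> (98/100 \<le> a\<^sup>2 \<and> 98/100 \<le> b\<^sup>2)"
    "\<not> (98/100 \<le> a\<^sup>2 \<and> \<bar>a + b\<bar> < 1/10)"
    "\<not> (\<bar>a + b\<bar> < 1/10 \<and> \<bar>a + c\<bar> < 1/10 \<and> \<bar>b + c\<bar> < 1/10)"
proof -
  show "\<not> (98/100 \<le> a\<^sup>2 \<and> 98/100 \<le> b\<^sup>2)" using assms zero_le_power2[of c] by linarith
  show "\<not> (98/100 \<le> a\<^sup>2 \<and> \<bar>a + b\<bar> < 1/10)"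
  proof
    assume *: "98/100 \<le> a\<^sup>2 \<and> \<bar>a + b\<bar> < 1/10"
    then have "(a + b)\<^sup>2 < (1/10)\<^sup>2" by (intro square_less_of_abs_less) auto
    then have "2 * (a + b)\<^sup>2 < 2/100" by (simp add: power_divide)
    moreover have "a\<^sup>2 \<le> 2 * (a + b)\<^sup>2 + 2 * b\<^sup>2"
      using zero_le_power2[of "a + 2 * b"] by (simp add: power2_eq_square algebra_simps)
    ultimately have "a\<^sup>2 < 2/100 + 2 * b\<^sup>2" by (rule le_less_trans[rotated, OF add_strict_right_mono])
    moreover have "98/100 \<le> a\<^sup>2" using * by blast
    ultimately show False using assms zero_le_power2[of c] by linarith
  qed
  show "\<not> (\<bar>a + b\<bar> < 1/10 \<and> \<bar>a + c\<bar> < 1/10 \<and> \<bar>b + c\<bar> < 1/10)"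
  proof
    assume "\<bar>a + b\<bar> < 1/10 \<and> \<bar>a + c\<bar> < 1/10 \<and> \<bar>b + c\<bar> < 1/10"
    then have "\<bar>a\<bar> < 1/5" "\<bar>b\<bar> < 1/5" "\<bar>c\<bar> < 1/5" by linarith+
    then have "a\<^sup>2 < (1/5)\<^sup>2" "b\<^sup>2 < (1/5)\<^sup>2" "c\<^sup>2 < (1/5)\<^sup>2"
      by (auto intro!: square_less_of_abs_less simp del: power_divide power_one_over)
    then show False using assms by (simp add: power2_eq_square)
  qed
qed

text \<open>
  The dual statement, with \<open>(a, b, c)\<close> as the unit normal of a plane. The normals of the flags have
  squared length 2, hence the threshold 198/100.
\<close>

lemma flag_generic_plane:
  fixes a b c :: real
  assumes 1: "a\<^sup>2 + b\<^sup>2 + c\<^sup>2 = 1"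
  shows "\<not> (\<bar>a\<bar> < 1/10 \<and> \<bar>b\<bar> < 1/10 \<and> \<bar>c\<bar> < 1/10)"
    "\<not> (198/100 \<le> (a + b)\<^sup>2 \<and> \<bar>a\<bar> < 1/10)"
    "\<not> (198/100 \<le> (a + b)\<^sup>2 \<and> 198/100 \<le> (a + c)\<^sup>2)"
proof -
  have square: "x\<^sup>2 < 1/100" if "\<bar>x\<bar> < 1/10" for x :: real
    using square_less_of_abs_less[OF that] by (simp add: power2_eq_square)
  show "\<not> (\<bar>a\<bar> < 1/10 \<and> \<bar>b\<bar> < 1/10 \<and> \<bar>c\<bar> < 1/10)"
    using square[of a] square[of b] square[of c] 1 by linarith
  have *: False if "198/100 \<le> (x + y)\<^sup>2" "x\<^sup>2 \<le> 1/100" "x\<^sup>2 + y\<^sup>2 \<le> 1" for x y :: real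
  proof -
    have "0 \<le> (5 * x - y)\<^sup>2" by simp
    then have "2 * x * y \<le> 5 * x\<^sup>2 + y\<^sup>2 / 5" by (simp add: power2_eq_square algebra_simps)
    then show False using that by (simp add: power2_sum)
  qed
  show "\<not> (198/100 \<le> (a + b)\<^sup>2 \<and> \<bar>a\<bar> < 1/10)"
    using *[of a b] square[of a] 1 zero_le_power2[of c] by auto
  show "\<not> (198/100 \<le> (a + b)\<^sup>2 \<and> 198/100 \<le> (a + c)\<^sup>2)"
  proof
    assume h: "198/100 \<le> (a + b)\<^sup>2 \<and> 198/100 \<le> (a + c)\<^sup>2"
    have "0 \<le> (a - b)\<^sup>2" by simp
    then have "(a + b)\<^sup>2 \<le> 2 * (a\<^sup>2 + b\<^sup>2)" by (simp add: power2_eq_square algebra_simps)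
    moreover have "198/100 \<le> (a + b)\<^sup>2" using h by blast
    ultimately have "198/100 \<le> 2 * (a\<^sup>2 + b\<^sup>2)" by (rule order_trans[rotated])
    then have "99/100 \<le> a\<^sup>2 + b\<^sup>2" by simp
    moreover have "c\<^sup>2 = 1 - (a\<^sup>2 + b\<^sup>2)" using 1 by simp
    ultimately have "c\<^sup>2 \<le> 1/100" by simp
    then show False using *[of c a] h 1 zero_le_power2[of b] by (simp add: add.commute)
  qed
qed

text \<open>
  The twelve inequalities in terms of \<open>w\<close> and \<open>u\<close>, where the three larger eigenvalues are \<open>w i + u i\<close>
  and the smaller positive ones are \<open>u i\<close>. The conditions in \<open>line_stable\<close> bound the total weight of
  a line that is one of the lines of the flags, or the intersection of two planes; those in
  \<open>plane_stable\<close> concern a plane that contains two of the lines, or is one of the planes.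
\<close>

locale stable_weights =
  fixes w u :: "3 \<Rightarrow> real" and \<gamma> :: real
  assumes w_pos: "\<And>i. 0 < w i" and u_pos: "\<And>i. 0 < u i"
    and trace: "(\<Sum>i\<in>UNIV. w i + 2 * u i) = 3 * \<gamma>"
    and line_stable: "\<And>i. w i + u i < \<gamma>" "\<And>i j. i \<noteq> j \<Longrightarrow> u i + u j < \<gamma>"
    and plane_stable: "\<And>i. \<gamma> < u 1 + u 2 + u 3 + w i"
      "\<And>i j. i \<noteq> j \<Longrightarrow> \<gamma> < w i + u i + w j + u j"
begin

text \<open>
  A uniform lower bound for the growth rate of the energy: the smallest margin in the twelve
  inequalities.
\<close>

definition slack :: real where
  "slack = Min ((\<lambda>i. \<gamma> - (w i + u i)) ` UNIV \<union> {\<gamma> - (u 1 + u 2), \<gamma> - (u 1 + u 3), \<gamma> - (u 2 + u 3)}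
     \<union> (\<lambda>i. u 1 + u 2 + u 3 + w i - \<gamma>) ` UNIV
     \<union> {w 1 + u 1 + w 2 + u 2 - \<gamma>, w 1 + u 1 + w 3 + u 3 - \<gamma>, w 2 + u 2 + w 3 + u 3 - \<gamma>})"

lemma slack_pos: "0 < slack"
  using line_stable(1) line_stable(2)[of 1 2] line_stable(2)[of 1 3] line_stable(2)[of 2 3]
    plane_stable(1) plane_stable(2)[of 1 2] plane_stable(2)[of 1 3] plane_stable(2)[of 2 3]
  unfolding slack_def by (subst Min_gr_iff) auto

lemma slack_le:
  "slack \<le> \<gamma> - (w 1 + u 1)" "slack \<le> \<gamma> - (w 2 + u 2)" "slack \<le> \<gamma> - (w 3 + u 3)"
  "slack \<le> \<gamma> - (u 1 + u 2)" "slack \<le> \<gamma> - (u 1 + u 3)" "slack \<le> \<gamma> - (u 2 + u 3)"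
  "slack \<le> u 1 + u 2 + u 3 + w 1 - \<gamma>" "slack \<le> u 1 + u 2 + u 3 + w 2 - \<gamma>"
  "slack \<le> u 1 + u 2 + u 3 + w 3 - \<gamma>"
  "slack \<le> w 1 + u 1 + w 2 + u 2 - \<gamma>" "slack \<le> w 1 + u 1 + w 3 + u 3 - \<gamma>"
  "slack \<le> w 2 + u 2 + w 3 + u 3 - \<gamma>"
  unfolding slack_def by (rule Min_le; simp)+

text \<open>
  \<open>A i\<close> stands for a line close to the line of flag \<open>i\<close>, and \<open>B i\<close> for a line close to its plane. The
  hypotheses are the combinations that general position excludes.
\<close>

lemma line_slack_cases:
  assumes "\<not> (A1 \<and> A2)" "\<not> (A1 \<and> A3)" "\<not> (A2 \<and> A3)" "\<not> (B1 \<and> B2 \<and> B3)"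
    "\<not> (A1 \<and> B2)" "\<not> (A1 \<and> B3)" "\<not> (A2 \<and> B1)" "\<not> (A2 \<and> B3)" "\<not> (A3 \<and> B1)" "\<not> (A3 \<and> B2)"
  shows "slack \<le> \<gamma> - (w 1 * of_bool A1 + u 1 * of_bool B1 + (w 2 * of_bool A2 + u 2 * of_bool B2)
     + (w 3 * of_bool A3 + u 3 * of_bool B3))"
  using assms
  by (cases A1; cases A2; cases A3; cases B1; cases B2; cases B3; simp;
      insert slack_le w_pos[of 1] w_pos[of 2] w_pos[of 3] u_pos[of 1] u_pos[of 2] u_pos[of 3];
      linarith)

text \<open>
  \<open>A i\<close> stands for a plane close to one that contains the line of flag \<open>i\<close>, and \<open>B i\<close> for a plane close
  to the plane of flag \<open>i\<close>.
\<close>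

lemma plane_slack_cases:
  assumes "\<not> (B1 \<and> B2)" "\<not> (B1 \<and> B3)" "\<not> (B2 \<and> B3)" "\<not> (A1 \<and> A2 \<and> A3)"
    "\<not> (A1 \<and> B2)" "\<not> (A1 \<and> B3)" "\<not> (A2 \<and> B1)" "\<not> (A2 \<and> B3)" "\<not> (A3 \<and> B1)" "\<not> (A3 \<and> B2)"
  shows "slack \<le> w 1 * of_bool (\<not> A1) + u 1 * of_bool (\<not> B1) + (w 2 * of_bool (\<not> A2) + u 2 * of_bool (\<not> B2))
     + (w 3 * of_bool (\<not> A3) + u 3 * of_bool (\<not> B3)) - \<gamma>"
  using assms
  by (cases A1; cases A2; cases A3; cases B1; cases B2; cases B3; simp;
      insert slack_le w_pos[of 1] w_pos[of 2] w_pos[of 3] u_pos[of 1] u_pos[of 2] u_pos[of 3];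
      linarith)

lemma line_slack:
  assumes "x \<bullet> x = 1"
  shows "slack \<le> \<gamma> - (\<Sum>i\<in>UNIV. w i * of_bool (98/100 \<le> (x $ i)\<^sup>2)
     + u i * of_bool (\<bar>x \<bullet> flag_normal i\<bar> < 1/10))"
proof -
  let ?a = "x $ 1" and ?b = "x $ 2" and ?c = "x $ 3"
  have 1: "?a\<^sup>2 + ?b\<^sup>2 + ?c\<^sup>2 = 1"
    using assms by (simp add: inner_vec_def sum_3 power2_eq_square)
  then have "?a\<^sup>2 + ?c\<^sup>2 + ?b\<^sup>2 = 1" "?b\<^sup>2 + ?a\<^sup>2 + ?c\<^sup>2 = 1" "?b\<^sup>2 + ?c\<^sup>2 + ?a\<^sup>2 = 1"
    "?c\<^sup>2 + ?a\<^sup>2 + ?b\<^sup>2 = 1" "?c\<^sup>2 + ?b\<^sup>2 + ?a\<^sup>2 = 1"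
    by simp_all
  moreover have comm: "?b + ?a = ?a + ?b" "?c + ?a = ?a + ?c" "?c + ?b = ?b + ?c"
    by simp_all
  note g = calculation[THEN flag_generic_line(1)] calculation[THEN flag_generic_line(2)]
    flag_generic_line[OF 1]
  show ?thesis
    unfolding sum_3 inner_flag_normal
    by (rule line_slack_cases; use g[unfolded comm] in blast)
qed

lemma plane_slack:
  assumes "x \<bullet> x = 1"
  shows "slack \<le> (\<Sum>i\<in>UNIV. w i * of_bool (\<not> \<bar>x $ i\<bar> < 1/10)
     + u i * of_bool (\<not> 198/100 \<le> (x \<bullet> flag_normal i)\<^sup>2)) - \<gamma>"
proof -
  let ?a = "x $ 1" and ?b = "x $ 2" and ?c = "x $ 3"
  have 1: "?a\<^sup>2 + ?b\<^sup>2 + ?c\<^sup>2 = 1"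
    using assms by (simp add: inner_vec_def sum_3 power2_eq_square)
  then have "?a\<^sup>2 + ?c\<^sup>2 + ?b\<^sup>2 = 1" "?b\<^sup>2 + ?a\<^sup>2 + ?c\<^sup>2 = 1" "?b\<^sup>2 + ?c\<^sup>2 + ?a\<^sup>2 = 1"
    "?c\<^sup>2 + ?a\<^sup>2 + ?b\<^sup>2 = 1" "?c\<^sup>2 + ?b\<^sup>2 + ?a\<^sup>2 = 1"
    by simp_all
  moreover have comm: "?b + ?a = ?a + ?b" "?c + ?a = ?a + ?c" "?c + ?b = ?b + ?c"
    by simp_all
  note g = calculation[THEN flag_generic_plane(2)] calculation[THEN flag_generic_plane(3)]
    flag_generic_plane[OF 1]
  show ?thesis
    unfolding sum_3 inner_flag_normal
    by (rule plane_slack_cases; use g[unfolded comm] in blast)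
qed

text \<open>
  Coercivity. Inserting the growth estimates turns the energy into a linear function of the
  logarithms \<open>t1 \<le> t2 \<le> t3\<close> of the squared singular values. The multiples of \<open>t1\<close> cancel by the
  trace condition, and the coefficients of \<open>t2 - t1\<close> and \<open>t3 - t2\<close> are the quantities bounded below
  by \<open>slack\<close> for the line spanned by \<open>e1\<close> and the plane orthogonal to \<open>e3\<close>.
\<close>

lemma flag_energy_growth:
  assumes sb: "singular_basis g e1 e2 e3" and g: "det g \<noteq> 0"
  shows "ln (1/100) * (\<Sum>i\<in>UNIV. w i + u i) + slack * (ln ((norm (g *v e3))\<^sup>2) - ln ((norm (g *v e1))\<^sup>2))
    \<le> flag_energy w u \<gamma> g"
proof -
  define t1 t2 t3 where t: "t1 = ln ((norm (g *v e1))\<^sup>2)" "t2 = ln ((norm (g *v e2))\<^sup>2)"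
    "t3 = ln ((norm (g *v e3))\<^sup>2)"
  have le: "0 \<le> t2 - t1" "0 \<le> t3 - t2"
    using sb singular_pos[OF sb g] by (auto simp: t singular_basis_def intro!: ln_mono power_mono)
  have unit: "e1 \<bullet> e1 = 1" "e3 \<bullet> e3 = 1" using sb by (auto simp: singular_basis_def)
  \<comment> \<open>Incidences with flag \<open>i\<close>: \<open>p\<close> and \<open>q\<close> indicate that the most contracted direction is close to the
    line or to the plane, \<open>r\<close> and \<open>s\<close> that the plane orthogonal to the most expanded direction is
    not close to containing the line or to being the plane.\<close>
  define p q r s where pqrs: "p i = (of_bool (98/100 \<le> (e1 $ i)\<^sup>2) :: real)"
    "q i = (of_bool (\<bar>e1 \<bullet> flag_normal i\<bar> < 1/10) :: real)"
    "r i = (of_bool (\<not> \<bar>e3 $ i\<bar> < 1/10) :: real)"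
    "s i = (of_bool (\<not> 198/100 \<le> (e3 \<bullet> flag_normal i)\<^sup>2) :: real)" for i
  have small: "x\<^sup>2 < 1/100" if "\<bar>x\<bar> < 1/10" for x :: real
    using square_less_of_abs_less[OF that] by (simp add: power2_eq_square)
  have line: "ln (1/100) + t1 + (t2 - t1) * (1 - p i) + (t3 - t2) * r i \<le> ln ((norm (g *v axis i 1))\<^sup>2)" for i
  proof -
    have sq: "(e1 $ i)\<^sup>2 + (e2 $ i)\<^sup>2 + (e3 $ i)\<^sup>2 = 1"
      using singular_parseval[OF sb, of "axis i 1"] by (simp add: inner_axis)
    let ?N = "1/10 \<le> \<bar>e2 $ i\<bar> \<or> 1/10 \<le> \<bar>e3 $ i\<bar>"
    have "1 - p i \<le> of_bool ?N"
      using sq small[of "e2 $ i"] small[of "e3 $ i"] by (auto simp: pqrs not_le)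
    moreover have "r i = of_bool (1/10 \<le> \<bar>e3 $ i\<bar>)" by (simp add: pqrs not_less)
    moreover have "1/10 \<le> \<bar>e1 $ i\<bar> \<or> 1/10 \<le> \<bar>e2 $ i\<bar> \<or> 1/10 \<le> \<bar>e3 $ i\<bar>"
      using sq small[of "e1 $ i"] small[of "e2 $ i"] small[of "e3 $ i"] by linarith
    then have "ln (1/100) + t1 + (t2 - t1) * of_bool ?N + (t3 - t2) * of_bool (1/10 \<le> \<bar>e3 $ i\<bar>)
        \<le> ln ((norm (g *v axis i 1))\<^sup>2)"
      using line_growth[OF sb g, of "1/10" "axis i 1"] by (simp add: t inner_axis power2_eq_square)
    ultimately show ?thesis
      using mult_left_mono[OF _ le(1), of "1 - p i" "of_bool ?N"] by simp
  qed
  have plane: "ln (1/100) + 2 * t1 + (t2 - t1) * (2 - q i) + (t3 - t2) * s i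
      \<le> ln ((norm (cofactor g (flag_normal i)))\<^sup>2)" for i
  proof -
    let ?f = "flag_normal i"
    have "(norm ?f)\<^sup>2 = 2"
      using exhaust_3[of i] by (auto simp: power2_norm_eq_inner inner_flag_normal) (auto simp: flag_normal_def)
    then have sq: "(e1 \<bullet> ?f)\<^sup>2 + (e2 \<bullet> ?f)\<^sup>2 + (e3 \<bullet> ?f)\<^sup>2 = 2"
      using singular_parseval[OF sb, of ?f] by simp
    let ?K = "1/10 \<le> \<bar>e1 \<bullet> ?f\<bar> \<or> 1/10 \<le> \<bar>e2 \<bullet> ?f\<bar>"
    have s: "s i \<le> of_bool ?K"
      using sq small[of "e1 \<bullet> ?f"] small[of "e2 \<bullet> ?f"] by (auto simp: pqrs not_le)
    have q: "2 - q i = 1 + of_bool (1/10 \<le> \<bar>e1 \<bullet> ?f\<bar>)" by (simp add: pqrs not_less)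
    have "1/10 \<le> \<bar>e1 \<bullet> ?f\<bar> \<or> 1/10 \<le> \<bar>e2 \<bullet> ?f\<bar> \<or> 1/10 \<le> \<bar>e3 \<bullet> ?f\<bar>"
      using sq small[of "e1 \<bullet> ?f"] small[of "e2 \<bullet> ?f"] small[of "e3 \<bullet> ?f"] by linarith
    from plane_growth[OF sb g _ this]
    have "ln ((1/10)\<^sup>2) + 2 * t1 + (t2 - t1) * (1 + of_bool (1/10 \<le> \<bar>e1 \<bullet> ?f\<bar>)) + (t3 - t2) * of_bool ?K
        \<le> ln ((norm (cofactor g ?f))\<^sup>2)"
      unfolding t by simp
    moreover have "(1/10 :: real)\<^sup>2 = 1/100" by (simp add: power_divide)
    ultimately show ?thesis
      unfolding q using mult_left_mono[OF s le(2)] by simp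
  qed
  define W where "W = (\<Sum>i\<in>UNIV. w i * p i + u i * q i)"
  define V where "V = (\<Sum>i\<in>UNIV. w i * r i + u i * s i)"
  have W: "slack \<le> \<gamma> - W" and V: "slack \<le> V - \<gamma>"
    using line_slack[OF unit(1)] plane_slack[OF unit(2)] by (simp_all add: W_def V_def pqrs)
  have "(\<Sum>i\<in>UNIV. (w i + u i) * ln (1/100) + (w i + 2 * u i) * t1
        + (t2 - t1) * ((w i + 2 * u i) - (w i * p i + u i * q i)) + (t3 - t2) * (w i * r i + u i * s i))
      \<le> (\<Sum>i\<in>UNIV. w i * ln ((norm (g *v axis i 1))\<^sup>2) + u i * ln ((norm (cofactor g (flag_normal i)))\<^sup>2))"
    (is "sum ?F _ \<le> ?S")
  proof (rule sum_mono)
    fix i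
    show "?F i \<le> w i * ln ((norm (g *v axis i 1))\<^sup>2) + u i * ln ((norm (cofactor g (flag_normal i)))\<^sup>2)"
      using mult_left_mono[OF line[of i], of "w i"] mult_left_mono[OF plane[of i], of "u i"]
        w_pos[of i] u_pos[of i]
      by (simp add: algebra_simps)
  qed
  also have "sum ?F UNIV = (\<Sum>i\<in>UNIV. w i + u i) * ln (1/100) + 3 * \<gamma> * t1 + (t2 - t1) * (3 * \<gamma> - W)
      + (t3 - t2) * V"
    by (simp only: sum.distrib sum_subtractf W_def V_def trace[symmetric] flip: sum_distrib_left sum_distrib_right)
  finally have S: "(\<Sum>i\<in>UNIV. w i + u i) * ln (1/100) + 3 * \<gamma> * t1 + (t2 - t1) * (3 * \<gamma> - W)
      + (t3 - t2) * V \<le> ?S" .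
  have "0 < \<gamma>"
    using line_stable(1)[of 1] w_pos[of 1] u_pos[of 1] by linarith
  then have "\<gamma> * ln ((det g)\<^sup>2) \<le> \<gamma> * (t1 + t2 + t3)"
    using det_growth[OF sb g] by (simp add: t)
  moreover have "(t2 - t1) * slack \<le> (t2 - t1) * (\<gamma> - W)" "(t3 - t2) * slack \<le> (t3 - t2) * (V - \<gamma>)"
    using W V le by (auto intro: mult_left_mono)
  ultimately show ?thesis
    using S unfolding flag_energy_def t[symmetric] by (simp add: algebra_simps)
qed

text \<open>
  Lengths, areas and the determinant have degrees 1, 2 and 3, so invariance under scaling is
  the trace condition.
\<close>

lemma flag_energy_scale:
  assumes "c > 0" "det g \<noteq> 0"
  shows "flag_energy w u \<gamma> (c *\<^sub>R g) = flag_energy w u \<gamma> g"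
proof -
  have l: "ln ((norm ((c *\<^sub>R g) *v axis i 1))\<^sup>2) = 2 * ln c + ln ((norm (g *v axis i 1))\<^sup>2)" for i
    using assms mult_eq_0_iff_det[OF assms(2), of "axis i 1"]
    by (simp add: scaleR_matrix_vector_assoc[symmetric] power_mult_distrib ln_mult ln_realpow axis_eq_0_iff)
  have p: "ln ((norm (cofactor (c *\<^sub>R g) (flag_normal i)))\<^sup>2)
      = 4 * ln c + ln ((norm (cofactor g (flag_normal i)))\<^sup>2)" for i
    using assms cofactor_eq_0_iff[OF assms(2), of "flag_normal i"] flag_normal_nonzero[of i]
    by (simp add: cofactor_scale_matrix power_mult_distrib ln_mult ln_realpow)
  have d: "ln ((det (c *\<^sub>R g))\<^sup>2) = 6 * ln c + ln ((det g)\<^sup>2)"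
    using assms by (simp add: det_scale_matrix power_mult_distrib ln_mult ln_realpow)
  have "(\<Sum>i\<in>UNIV. w i * (2 * ln c) + u i * (4 * ln c)) = 2 * ln c * (\<Sum>i\<in>UNIV. w i + 2 * u i)"
    unfolding sum_distrib_left by (simp add: algebra_simps)
  then have s: "(\<Sum>i\<in>UNIV. w i * (2 * ln c) + u i * (4 * ln c)) = \<gamma> * (6 * ln c)"
    by (simp add: trace)
  show ?thesis
    unfolding flag_energy_def l p d using s
    by (simp add: distrib_left sum.distrib)
qed

lemma frobenius_norm: "(norm g)\<^sup>2 = (\<Sum>i\<in>UNIV. (norm (g *v axis i 1))\<^sup>2)" for g :: "real ^ 3 ^ 3"
  unfolding power2_norm_eq_inner by (simp add: inner_vec_def sum_3 matrix_vector_mult_def axis_def)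

text \<open>
  On a sublevel set the ratio of the extreme singular values is bounded, and for matrices of
  Frobenius norm 1 the largest squared singular value is at least 1/3. So the smallest one stays
  away from 0.
\<close>

lemma flag_energy_sublevel:
  obtains r where "0 < r"
    "\<And>g x. det g \<noteq> 0 \<Longrightarrow> norm g = 1 \<Longrightarrow> flag_energy w u \<gamma> g \<le> E \<Longrightarrow> r * norm x \<le> norm (g *v x)"
proof -
  define R where "R = (E - ln (1/100) * (\<Sum>i\<in>UNIV. w i + u i)) / slack"
  show ?thesis
  proof
    show "0 < sqrt (exp (- R) / 3)" by simp
    fix g x
    assume g: "det g \<noteq> 0" "norm g = 1" "flag_energy w u \<gamma> g \<le> E"
    obtain e1 e2 e3 where sb: "singular_basis g e1 e2 e3" by (rule ex_singular_basis)
    let ?l1 = "(norm (g *v e1))\<^sup>2" and ?l2 = "(norm (g *v e2))\<^sup>2" and ?l3 = "(norm (g *v e3))\<^sup>2"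
    note pos = singular_pos[OF sb g(1)]
    have le: "?l1 \<le> ?l2" "?l2 \<le> ?l3"
      using sb by (auto simp: singular_basis_def intro: power_mono)
    have "slack * (ln ?l3 - ln ?l1) \<le> E - ln (1/100) * (\<Sum>i\<in>UNIV. w i + u i)"
      using flag_energy_growth[OF sb g(1)] g(3) by linarith
    then have "ln ?l3 - ln ?l1 \<le> R"
      using slack_pos by (simp add: R_def field_simps)
    then have "ln (exp (- R) * ?l3) \<le> ln ?l1"
      using pos by (simp add: ln_mult)
    then have l1: "exp (- R) * ?l3 \<le> ?l1"
      using pos by (subst (asm) ln_le_cancel_iff) auto
    have "(norm (g *v y))\<^sup>2 \<le> ?l3 * (norm y)\<^sup>2" for y
      unfolding norm_singular_mult[OF sb, of y] singular_parseval[OF sb, of y] distrib_left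
      using le by (intro add_mono) (auto simp: mult.commute intro: mult_left_mono order_trans)
    from this[of "axis _ 1"] have "(norm g)\<^sup>2 \<le> (\<Sum>i\<in>(UNIV :: 3 set). ?l3)"
      unfolding frobenius_norm by (intro sum_mono) simp
    then have "1 \<le> 3 * ?l3" using g(2) by simp
    then have "exp (- R) / 3 * 1 \<le> exp (- R) / 3 * (3 * ?l3)"
      by (rule mult_left_mono) simp
    also have "\<dots> = exp (- R) * ?l3" by simp
    also note l1
    finally have *: "exp (- R) / 3 \<le> ?l1" by simp
    have "?l1 * (norm x)\<^sup>2 \<le> (norm (g *v x))\<^sup>2"
      unfolding norm_singular_mult[OF sb, of x] singular_parseval[OF sb, of x] distrib_left
      using le by (intro add_mono) (auto simp: mult.commute intro: mult_left_mono order_trans)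
    then have "exp (- R) / 3 * (norm x)\<^sup>2 \<le> (norm (g *v x))\<^sup>2"
      using mult_right_mono[OF *, of "(norm x)\<^sup>2"] by simp
    then have "sqrt (exp (- R) / 3 * (norm x)\<^sup>2) \<le> norm (g *v x)"
      using real_le_lsqrt[of "norm (g *v x)"] by (simp add: real_le_lsqrt)
    then show "sqrt (exp (- R) / 3) * norm x \<le> norm (g *v x)"
      by (simp only: real_sqrt_mult real_sqrt_abs abs_norm_cancel)
  qed
qed

lemma ex_flag_energy_minimizer:
  obtains g where "det g \<noteq> 0" "\<And>h. det h \<noteq> 0 \<Longrightarrow> flag_energy w u \<gamma> g \<le> flag_energy w u \<gamma> h"
proof -
  let ?E = "flag_energy w u \<gamma>"
  let ?I = "mat 1 :: real ^ 3 ^ 3"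
  obtain r where r: "0 < r" "\<And>g x. det g \<noteq> 0 \<Longrightarrow> norm g = 1 \<Longrightarrow> ?E g \<le> ?E ?I \<Longrightarrow> r * norm x \<le> norm (g *v x)"
    using flag_energy_sublevel by blast
  define K where "K = {g :: real ^ 3 ^ 3. norm g = 1 \<and> (\<forall>x. r * norm x \<le> norm (g *v x))}"
  have mult_cont: "continuous_on S (\<lambda>g. g *v x)" for S and x :: "real ^ 3"
    unfolding matrix_vector_mult_def by (intro continuous_intros)
  have "closed K"
    unfolding K_def
    by (intro closed_Collect_conj closed_Collect_all closed_Collect_eq closed_Collect_le
        continuous_intros mult_cont)
  moreover have "bounded K" unfolding K_def bounded_iff by auto
  ultimately have "compact K" by (simp add: compact_eq_bounded_closed)
  have det: "det g \<noteq> 0" if "g \<in> K" for g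
  proof
    assume "det g = 0"
    then obtain x where "x \<noteq> 0" "g *v x = 0"
      using invertible_det_nz[of g] by (metis invertible_left_inverse matrix_left_invertible_ker)
    moreover have "r * norm x \<le> norm (g *v x)" using that by (simp add: K_def)
    ultimately show False using r(1) by (simp add: mult_le_0_iff)
  qed
  have "continuous_on K ?E"
  proof -
    have "continuous_on K (\<lambda>g. cofactor g x)" for x
      unfolding cofactor_def column_def by (intro continuous_intros continuous_on_cross)
    moreover have "continuous_on K (det :: real ^ 3 ^ 3 \<Rightarrow> real)"
      unfolding det_3 by (intro continuous_intros)
    ultimately show ?thesis
      unfolding flag_energy_def
      by (intro continuous_intros mult_cont)
        (use det flag_normal_nonzero in \<open>auto simp: mult_eq_0_iff_det cofactor_eq_0_iff axis_eq_0_iff\<close>)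
  qed
  have normalize: "(1 / norm h) *\<^sub>R h \<in> K \<and> ?E ((1 / norm h) *\<^sub>R h) = ?E h" if "det h \<noteq> 0" "?E h \<le> ?E ?I" for h
  proof -
    have "h \<noteq> 0" using that(1) by (auto simp: det_3)
    then have c: "1 / norm h > 0" by simp
    show ?thesis
      using flag_energy_scale[OF c that(1)] r(2)[of "(1 / norm h) *\<^sub>R h"] that \<open>h \<noteq> 0\<close>
      by (simp add: K_def det_scale_matrix)
  qed
  have "K \<noteq> {}" using normalize[of ?I] by auto
  then obtain g where g: "g \<in> K" "\<And>h. h \<in> K \<Longrightarrow> ?E g \<le> ?E h"
    using continuous_attains_inf[OF \<open>compact K\<close> _ \<open>continuous_on K ?E\<close>] by blast
  show ?thesis
  proof
    show "det g \<noteq> 0" by (rule det[OF g(1)])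
    have "?E g \<le> ?E h" if "det h \<noteq> 0" "?E h \<le> ?E ?I" for h
      using normalize[OF that] g(2) by metis
    then show "?E g \<le> ?E h" if "det h \<noteq> 0" for h
      using that by (metis det_I linear order_trans zero_neq_one)
  qed
qed

text \<open>
  First variation along \<open>h t = (1 + t y y\<^sup>T) g\<close>. Matrices \<open>y y\<^sup>T\<close> span the symmetric matrices, and
  for a rank-one perturbation lengths, areas and the determinant are explicit polynomials
  in \<open>t\<close>.
\<close>

lemma flag_energy_critical:
  assumes g: "det g \<noteq> 0" and min: "\<And>h. det h \<noteq> 0 \<Longrightarrow> flag_energy w u \<gamma> g \<le> flag_energy w u \<gamma> h"
  shows "(\<Sum>i\<in>UNIV. w i * ((y \<bullet> (g *v axis i 1))\<^sup>2 / (norm (g *v axis i 1))\<^sup>2)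
     + u i * ((norm y)\<^sup>2 - (y \<bullet> cofactor g (flag_normal i))\<^sup>2 / (norm (cofactor g (flag_normal i)))\<^sup>2))
     = \<gamma> * (norm y)\<^sup>2"
proof -
  define s where "s = (norm y)\<^sup>2"
  define h where "h t = g + t *\<^sub>R (\<chi> i j. y $ i * (y \<bullet> column j g))" for t
  have s: "y \<bullet> y = s" by (simp add: s_def power2_norm_eq_inner)
  have hcol: "column j (h t) = column j g + (t * (y \<bullet> column j g)) *\<^sub>R y" for t j
    by (simp add: h_def column_def vec_eq_iff)
  have hv: "h t *v x = g *v x + (t * (y \<bullet> (g *v x))) *\<^sub>R y" for t x
    unfolding matrix_mult_sum[of _ x] hcol
    by (simp add: sum_3 inner_add_right scalar_mult_eq_scaleR scaleR_add_right scaleR_add_left algebra_simps)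
  have cross: "(a + (t * (y \<bullet> a)) *\<^sub>R y) \<times> (b + (t * (y \<bullet> b)) *\<^sub>R y)
      = (1 + t * s) *\<^sub>R (a \<times> b) - (t * (y \<bullet> (a \<times> b))) *\<^sub>R y" for t a b
    unfolding s[symmetric] by (simp add: cross3_simps forall_3)
  have hc: "cofactor (h t) x = (1 + t * s) *\<^sub>R cofactor g x - (t * (y \<bullet> cofactor g x)) *\<^sub>R y" for t x
    unfolding cofactor_def hcol cross
    by (simp add: inner_add_right scaleR_add_right scaleR_add_left scaleR_diff_right algebra_simps)
  have hd: "det (h t) = (1 + t * s) * det g" for t
  proof -
    let ?a = "axis 1 1 :: real ^ 3"
    have d: "det k = (k *v ?a) \<bullet> cofactor k ?a" for k :: "real ^ 3 ^ 3"
      using inner_cofactor[of k ?a ?a] by (simp add: inner_axis_axis)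
    show ?thesis
      unfolding d[of "h t"] d[of g] hv hc
      by (simp add: inner_add_left inner_diff_right s inner_commute algebra_simps)
  qed
  have nv: "(norm (h t *v x))\<^sup>2 = (norm (g *v x))\<^sup>2 + 2 * t * (y \<bullet> (g *v x))\<^sup>2 + t\<^sup>2 * (y \<bullet> (g *v x))\<^sup>2 * s" for t x
    unfolding hv s_def power2_norm_eq_inner
    by (simp add: inner_add_left inner_add_right inner_commute power2_eq_square algebra_simps)
  have nc: "(norm (cofactor (h t) x))\<^sup>2 = (1 + t * s)\<^sup>2 * (norm (cofactor g x))\<^sup>2
      - 2 * (1 + t * s) * t * (y \<bullet> cofactor g x)\<^sup>2 + t\<^sup>2 * (y \<bullet> cofactor g x)\<^sup>2 * s" for t x
    unfolding hc s_def power2_norm_eq_inner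
    by (simp add: inner_diff_left inner_diff_right inner_commute power2_eq_square algebra_simps)
  have pos: "norm (g *v axis i 1) \<noteq> 0" "norm (cofactor g (flag_normal i)) \<noteq> 0" for i
    using g flag_normal_nonzero by (auto simp: mult_eq_0_iff_det cofactor_eq_0_iff axis_eq_0_iff)
  define D where "D = (\<Sum>i\<in>UNIV. w i * (2 * (y \<bullet> (g *v axis i 1))\<^sup>2 / (norm (g *v axis i 1))\<^sup>2)
     + u i * ((2 * s * (norm (cofactor g (flag_normal i)))\<^sup>2 - 2 * (y \<bullet> cofactor g (flag_normal i))\<^sup>2)
         / (norm (cofactor g (flag_normal i)))\<^sup>2)) - \<gamma> * (2 * s)"
  have "((\<lambda>t. ln (N + 2 * t * a + t\<^sup>2 * a * s)) has_real_derivative 2 * a / N) (at 0)"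
    if "N > 0" for N a
    by (rule derivative_eq_intros refl | use that in simp)+
  moreover have "((\<lambda>t. ln ((1 + t * s)\<^sup>2 * N - 2 * (1 + t * s) * t * a + t\<^sup>2 * a * s))
      has_real_derivative (2 * s * N - 2 * a) / N) (at 0)" if "N > 0" for N a
    by (rule derivative_eq_intros refl | use that in simp)+
  moreover have "((\<lambda>t. ln (((1 + t * s) * det g)\<^sup>2)) has_real_derivative 2 * s) (at 0)"
  proof -
    have "0 < det g * det g" using g not_real_square_gt_zero by blast
    then show ?thesis by (auto intro!: derivative_eq_intros simp: g power2_eq_square)
  qed
  ultimately have "((\<lambda>t. flag_energy w u \<gamma> (h t)) has_real_derivative D) (at 0)"
    unfolding flag_energy_def nv nc hd D_def using pos
    by (intro DERIV_diff DERIV_sum DERIV_add DERIV_cmult) auto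
  \<comment> \<open>For \<open>\<bar>t\<bar> < 1 / (s + 1)\<close> the factor \<open>1 + t * s\<close> is positive, so \<open>h t\<close> stays invertible.\<close>
  moreover have "flag_energy w u \<gamma> (h 0) \<le> flag_energy w u \<gamma> (h t)" if "\<bar>0 - t\<bar> < 1 / (s + 1)" for t
  proof -
    have "s \<ge> 0" by (simp add: s_def)
    then have "\<bar>t * s\<bar> < 1"
      using that by (simp add: abs_mult field_simps)
    then have "det (h t) \<noteq> 0" using g by (simp add: hd abs_less_iff)
    moreover have "h 0 = g" by (simp add: h_def)
    ultimately show ?thesis using min by simp
  qed
  moreover have "0 < 1 / (s + 1)" by (simp add: s_def add_nonneg_pos)
  ultimately have "D = 0" using DERIV_local_min by blast
  moreover have "D = 2 * (\<Sum>i\<in>UNIV. w i * ((y \<bullet> (g *v axis i 1))\<^sup>2 / (norm (g *v axis i 1))\<^sup>2)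
     + u i * (s - (y \<bullet> cofactor g (flag_normal i))\<^sup>2 / (norm (cofactor g (flag_normal i)))\<^sup>2)) - 2 * (\<gamma> * s)"
    unfolding D_def sum_distrib_left using pos by (simp add: diff_divide_distrib algebra_simps)
  ultimately show ?thesis by (simp add: s_def)
qed

end

section \<open>Sufficiency: from critical flags to representations\<close>

definition of_real_vec :: "real ^ 'n \<Rightarrow> complex ^ 'n" where
  "of_real_vec x = (\<chi> i. of_real (x $ i))"

lemma hinner_of_real_vec: "hinner (of_real_vec x) (of_real_vec y) = of_real (x \<bullet> y)"
  by (simp add: hinner_def of_real_vec_def inner_vec_def)

text \<open>
  A Hermitian matrix is determined by its quadratic form; here by polarisation, with all
  vectors real.
\<close>

lemma quadratic_form_matrix:
  fixes n k :: "3 \<Rightarrow> real ^ 3"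
  assumes quad: "\<And>y. (\<Sum>i\<in>UNIV. a i * (y \<bullet> n i)\<^sup>2 + b i * (y \<bullet> k i)\<^sup>2) = \<gamma> * (norm y)\<^sup>2"
  shows "(\<Sum>i\<in>UNIV. mat (of_real (a i)) ** proj (of_real_vec (n i)) + mat (of_real (b i)) ** proj (of_real_vec (k i)))
    = mat (of_real \<gamma>)"
proof -
  have "(\<Sum>i\<in>UNIV. a i * ((y \<bullet> n i) * (z \<bullet> n i)) + b i * ((y \<bullet> k i) * (z \<bullet> k i))) = \<gamma> * (y \<bullet> z)" for y z
  proof -
    let ?q = "\<lambda>y. \<Sum>i\<in>UNIV. a i * (y \<bullet> n i)\<^sup>2 + b i * (y \<bullet> k i)\<^sup>2"
    have "?q (y + z) - ?q y - ?q z
        = 2 * (\<Sum>i\<in>UNIV. a i * ((y \<bullet> n i) * (z \<bullet> n i)) + b i * ((y \<bullet> k i) * (z \<bullet> k i)))"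
      unfolding sum_subtractf[symmetric] sum_distrib_left
      by (rule sum.cong) (simp_all add: inner_add_left power2_eq_square algebra_simps)
    moreover have "\<gamma> * (norm (y + z))\<^sup>2 - \<gamma> * (norm y)\<^sup>2 - \<gamma> * (norm z)\<^sup>2 = 2 * (\<gamma> * (y \<bullet> z))"
      unfolding power2_norm_eq_inner by (simp add: inner_add_left inner_add_right inner_commute algebra_simps)
    ultimately show ?thesis using quad by simp
  qed
  note polar = this
  have entry: "(\<Sum>l\<in>UNIV. a l * (n l $ i * n l $ j) + b l * (k l $ i * k l $ j)) = (if i = j then \<gamma> else 0)" for i j
    using polar[of "axis i 1" "axis j 1"] by (simp add: inner_axis') (simp add: axis_def)
  have "(\<Sum>l\<in>UNIV. mat (of_real (a l)) ** proj (of_real_vec (n l)) + mat (of_real (b l)) ** proj (of_real_vec (k l))) $ i $ j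
      = of_real (\<Sum>l\<in>UNIV. a l * (n l $ i * n l $ j) + b l * (k l $ i * k l $ j))" for i j
    by (simp add: mat_mult_nth proj_def of_real_vec_def)
  then show ?thesis by (simp add: vec_eq_iff entry) (simp add: mat_def)
qed

text \<open>
  Invariance under a rank-one projection forces its vector into \<open>W\<close> or \<open>W\<close> into its orthogonal
  complement. If some \<open>n i\<close> lies in \<open>W\<close>, general position pulls every \<open>m j\<close> with \<open>j \<noteq> i\<close> into
  \<open>W\<close>, and these in turn pull in all \<open>n l\<close>; otherwise \<open>W\<close> is orthogonal to all \<open>n i\<close>.
\<close>

lemma generic_flags_irreducible:
  fixes n m :: "3 \<Rightarrow> complex ^ 3"
  assumes W: "vec.subspace W"
    and inv: "\<And>i v. v \<in> W \<Longrightarrow> proj (n i) *v v \<in> W" "\<And>i v. v \<in> W \<Longrightarrow> proj (m i) *v v \<in> W"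
    and generic: "\<And>i j. i \<noteq> j \<Longrightarrow> hinner (n i) (m j) \<noteq> 0"
    and separating: "\<And>v. (\<And>i. hinner (n i) v = 0) \<Longrightarrow> v = 0"
    and spanning: "\<And>v. \<exists>c. v = (\<Sum>i\<in>UNIV. c i *s n i)"
  shows "W = {0} \<or> W = UNIV"
proof -
  have dichotomy: "z \<in> W" if inv: "\<And>v. v \<in> W \<Longrightarrow> proj z *v v \<in> W" and v: "v \<in> W" "hinner z v \<noteq> 0" for z v
  proof -
    have "inverse (hinner z v) *s (proj z *v v) \<in> W"
      using W inv[OF v(1)] by (rule vec.subspace_scale)
    then show ?thesis using v(2) by (simp add: proj_mult)
  qed
  have nm: "m j \<in> W" if "n i \<in> W" "i \<noteq> j" for i j
    using dichotomy[OF inv(2) that(1), of j] generic[OF that(2)] by (simp add: hinner_commute[of "m j"])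
  have mn: "n i \<in> W" if "m j \<in> W" "i \<noteq> j" for i j
    using dichotomy[OF inv(1) that(1), of i] generic[OF that(2)] by simp
  show ?thesis
  proof (cases "\<exists>i. n i \<in> W")
    case True
    then obtain i where i: "n i \<in> W" by blast
    have n: "n j \<in> W" for j
    proof -
      have "\<exists>l. l \<noteq> i \<and> l \<noteq> j"
      proof (rule ccontr)
        assume "\<not> ?thesis"
        then have "\<forall>l. l = i \<or> l = j" by blast
        then show False unfolding forall_3 using exhaust_3[of i] by auto
      qed
      then obtain l where "l \<noteq> i" "l \<noteq> j" by blast
      then show ?thesis using nm[OF i, of l] mn[of l j] by simp
    qed
    then have "v \<in> W" for v
      using spanning[of v] W n by (auto intro!: vec.subspace_sum vec.subspace_scale)
    then show ?thesis by blast
  next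
    case False
    then have "v = 0" if "v \<in> W" for v
      using separating dichotomy[OF inv(1) that] by blast
    then show ?thesis using vec.subspace_0[OF W] by blast
  qed
qed

lemma mult_transpose_eq_0_iff:
  fixes A :: "'a::field ^ 'n ^ 'n"
  assumes "det A \<noteq> 0" "transpose A *v v = 0" shows "v = 0"
  using assms by (metis det_transpose invertible_det_nz invertible_left_inverse matrix_left_invertible_ker)

text \<open>
  At a minimiser \<open>g\<close> of the energy, the unit vectors \<open>n i\<close>, \<open>k i\<close> and \<open>m i\<close> point along the image
  of line \<open>i\<close>, along its orthogonal complement in the image of plane \<open>i\<close>, and along the normal of that
  image. They become the eigenvectors of the three matrices.
\<close>

lemma strict_horn_imp_irreducible:
  fixes \<alpha>1 \<alpha>2 \<beta>1 \<beta>2 \<delta>1 \<delta>2 \<gamma> :: real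
  assumes pos: "\<alpha>1 > \<alpha>2" "\<alpha>2 > 0" "\<beta>1 > \<beta>2" "\<beta>2 > 0" "\<delta>1 > \<delta>2" "\<delta>2 > 0"
    and trace: "\<alpha>1 + \<alpha>2 + \<beta>1 + \<beta>2 + \<delta>1 + \<delta>2 = 3 * \<gamma>"
    and horn: "\<gamma> < \<alpha>1 + \<beta>1" "\<gamma> < \<alpha>1 + \<delta>1" "\<gamma> < \<beta>1 + \<delta>1"
      "\<gamma> < \<alpha>1 + \<beta>2 + \<delta>2" "\<gamma> < \<alpha>2 + \<beta>1 + \<delta>2" "\<gamma> < \<alpha>2 + \<beta>2 + \<delta>1"
      "\<alpha>1 < \<gamma>" "\<beta>1 < \<gamma>" "\<delta>1 < \<gamma>" "\<alpha>2 + \<beta>2 < \<gamma>" "\<alpha>2 + \<delta>2 < \<gamma>" "\<beta>2 + \<delta>2 < \<gamma>"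
  obtains M :: "E6_gen \<Rightarrow> complex ^ 3 ^ 3"
  where "E6_relations \<alpha>1 \<alpha>2 \<beta>1 \<beta>2 \<delta>1 \<delta>2 \<gamma> M" "\<And>x. rank (M x) = 1"
    "\<forall>W. common_invariant M W \<longrightarrow> W = {0} \<or> W = UNIV"
proof -
  define a b :: "3 \<Rightarrow> real" where ab: "a = (\<lambda>i. if i = 1 then \<alpha>1 else if i = 2 then \<beta>1 else \<delta>1)"
    "b = (\<lambda>i. if i = 1 then \<alpha>2 else if i = 2 then \<beta>2 else \<delta>2)"
  interpret stable_weights "\<lambda>i. a i - b i" b \<gamma>
  proof
    fix i j :: 3
    show "0 < a i - b i" "0 < b i" "a i - b i + b i < \<gamma>" "\<gamma> < b 1 + b 2 + b 3 + (a i - b i)"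
      using pos horn exhaust_3[of i] by (auto simp: ab)
    show "b i + b j < \<gamma>" "\<gamma> < a i - b i + b i + (a j - b j) + b j" if "i \<noteq> j"
      using horn exhaust_3[of i] exhaust_3[of j] that by (auto simp: ab add.commute)
  qed (use trace in \<open>simp add: sum_3 ab\<close>)
  obtain g where g: "det g \<noteq> 0"
    "\<And>h. det h \<noteq> 0 \<Longrightarrow> flag_energy (\<lambda>i. a i - b i) b \<gamma> g \<le> flag_energy (\<lambda>i. a i - b i) b \<gamma> h"
    using ex_flag_energy_minimizer by blast
  define p q where pq: "p i = g *v axis i 1" "q i = cofactor g (flag_normal i)" for i
  have nz: "p i \<noteq> 0" "q i \<noteq> 0" for i
    using g(1) flag_normal_nonzero by (auto simp: pq mult_eq_0_iff_det cofactor_eq_0_iff axis_eq_0_iff)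
  define n m k where nmk: "n i = (1 / norm (p i)) *\<^sub>R p i" "m i = (1 / norm (q i)) *\<^sub>R q i"
    "k i = m i \<times> n i" for i
  have pq_inner: "p i \<bullet> q j = (if i = j then 0 else det g)" for i j
    unfolding pq inner_cofactor by (simp add: inner_axis' flag_normal_def)
  have unit: "n i \<bullet> n i = 1" "m i \<bullet> m i = 1" "n i \<bullet> m i = 0" for i
    using nz by (simp_all add: nmk pq_inner dot_square_norm power2_eq_square)
  have k_unit: "k i \<bullet> k i = 1" "n i \<bullet> k i = 0" "m i \<bullet> k i = 0" for i
  proof -
    have "(norm (k i))\<^sup>2 + (m i \<bullet> n i)\<^sup>2 = (norm (m i) * norm (n i))\<^sup>2"
      unfolding nmk(3) by (rule norm_cross_dot)
    then show "k i \<bullet> k i = 1"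
      using unit[of i] by (simp add: power_mult_distrib power2_norm_eq_inner inner_commute)
  qed (simp_all add: nmk(3) dot_cross_self)
  have flip: "m i \<bullet> n i = 0" "k i \<bullet> n i = 0" "k i \<bullet> m i = 0" for i
    using unit(3)[of i] k_unit(2,3)[of i] by (simp_all add: inner_commute)
  have parseval: "(norm y)\<^sup>2 = (y \<bullet> n i)\<^sup>2 + (y \<bullet> m i)\<^sup>2 + (y \<bullet> k i)\<^sup>2" for y i
    using orthonormal_cross_parseval[OF unit(2)[of i] unit(1)[of i] flip(1)[of i], of y]
    by (simp add: nmk(3) inner_commute add.commute)
  have quad: "(\<Sum>i\<in>UNIV. a i * (y \<bullet> n i)\<^sup>2 + b i * (y \<bullet> k i)\<^sup>2) = \<gamma> * (norm y)\<^sup>2" for y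
  proof -
    have "(y \<bullet> p i)\<^sup>2 / (norm (p i))\<^sup>2 = (y \<bullet> n i)\<^sup>2" "(y \<bullet> q i)\<^sup>2 / (norm (q i))\<^sup>2 = (y \<bullet> m i)\<^sup>2" for i
      by (simp_all add: nmk power_divide)
    then have "(\<Sum>i\<in>UNIV. (a i - b i) * (y \<bullet> n i)\<^sup>2 + b i * ((norm y)\<^sup>2 - (y \<bullet> m i)\<^sup>2)) = \<gamma> * (norm y)\<^sup>2"
      using flag_energy_critical[OF g, of y] by (simp add: pq)
    moreover have "(a i - b i) * (y \<bullet> n i)\<^sup>2 + b i * ((norm y)\<^sup>2 - (y \<bullet> m i)\<^sup>2)
        = a i * (y \<bullet> n i)\<^sup>2 + b i * (y \<bullet> k i)\<^sup>2" for i
      unfolding parseval[of y i] by (simp add: algebra_simps)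
    ultimately show ?thesis by simp
  qed
  let ?n = "\<lambda>i. of_real_vec (n i)" and ?m = "\<lambda>i. of_real_vec (m i)" and ?k = "\<lambda>i. of_real_vec (k i)"
  define M where "M x = (case x of P1 \<Rightarrow> proj (?n 1) | P2 \<Rightarrow> proj (?k 1) | Q1 \<Rightarrow> proj (?n 2)
    | Q2 \<Rightarrow> proj (?k 2) | S1 \<Rightarrow> proj (?n 3) | S2 \<Rightarrow> proj (?k 3))" for x
  have M: "\<exists>z. M x = proj z \<and> hinner z z = 1" for x
    by (cases x) (auto simp: M_def hinner_of_real_vec unit k_unit)
  show ?thesis
  proof
    show "rank (M x) = 1" for x using M[of x] rank_proj by metis
    have "adjoint_matrix (M x) = M x \<and> M x ** M x = M x" for x
      using M[of x] adjoint_proj proj_idem by metis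
    moreover have "M P1 ** M P2 = 0" "M P2 ** M P1 = 0" "M Q1 ** M Q2 = 0" "M Q2 ** M Q1 = 0"
      "M S1 ** M S2 = 0" "M S2 ** M S1 = 0"
      by (simp_all add: M_def proj_orthogonal hinner_of_real_vec k_unit flip)
    moreover have "mat (of_real \<alpha>1) ** M P1 + mat (of_real \<alpha>2) ** M P2 + mat (of_real \<beta>1) ** M Q1
      + mat (of_real \<beta>2) ** M Q2 + mat (of_real \<delta>1) ** M S1 + mat (of_real \<delta>2) ** M S2 = mat (of_real \<gamma>)"
      using quadratic_form_matrix[OF quad] by (simp add: sum_3 ab M_def add.assoc)
    ultimately show "E6_relations \<alpha>1 \<alpha>2 \<beta>1 \<beta>2 \<delta>1 \<delta>2 \<gamma> M"
      by (simp add: E6_relations_def)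
    have "W = {0} \<or> W = UNIV" if W: "common_invariant M W" for W
    proof -
      have sub: "vec.subspace W" and inv: "\<And>x v. v \<in> W \<Longrightarrow> M x *v v \<in> W"
        using W by (auto simp: common_invariant_def)
      have inv_n: "proj (?n i) *v v \<in> W" and inv_k: "proj (?k i) *v v \<in> W" if "v \<in> W" for i v
        using exhaust_3[of i] inv[OF that, of P1] inv[OF that, of P2] inv[OF that, of Q1]
          inv[OF that, of Q2] inv[OF that, of S1] inv[OF that, of S2] by (auto simp: M_def)
      have basis: "unitary_basis (\<lambda>l. if l = 1 then ?n i else if l = 2 then ?k i else ?m i)" for i
        unfolding unitary_basis_def forall_3
        by (simp add: hinner_of_real_vec unit k_unit flip)
      have inv_m: "proj (?m i) *v v \<in> W" if "v \<in> W" for i v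
      proof -
        have "v = proj (?n i) *v v + proj (?k i) *v v + proj (?m i) *v v"
          using unitary_basis_expand[OF basis[of i], of v] by (simp add: sum_3 proj_mult)
        then have "proj (?m i) *v v = v - (proj (?n i) *v v + proj (?k i) *v v)"
          by (simp add: algebra_simps)
        then show ?thesis
          using that inv_n inv_k sub by (metis vec.subspace_add vec.subspace_diff)
      qed
      have generic: "hinner (?n i) (?m j) \<noteq> 0" if "i \<noteq> j" for i j
        using that nz[of i] nz[of j] g(1) by (simp add: hinner_of_real_vec nmk pq_inner)
      define G :: "complex ^ 3 ^ 3" where "G = (\<chi> i j. of_real (g $ i $ j))"
      have "det G = of_real (det g)" by (simp add: det_3 G_def)
      then have G: "det G \<noteq> 0" using g(1) by simp
      have n_col: "?n i = of_real (1 / norm (p i)) *s column i G" for i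
        by (simp add: vec_eq_iff of_real_vec_def nmk pq column_def G_def matrix_vector_mult_basis)
      have c: "complex_of_real (1 / norm (p i)) \<noteq> 0" for i using nz by simp
      \<comment> \<open>The columns of \<open>G\<close> are the images of the three lines, so independence of the \<open>n i\<close> over the
      complex numbers is invertibility of \<open>G\<close>.\<close>
    have separating: "v = 0" if "\<And>i. hinner (?n i) v = 0" for v
      proof (rule mult_transpose_eq_0_iff[OF G])
        have "hinner (column i G) v = 0" for i
          using that[of i] c[of i] unfolding n_col hinner_scale_left by simp
        then show "transpose G *v v = 0"
          by (simp add: vec_eq_iff matrix_vector_mult_def transpose_def hinner_def column_def G_def)
      qed
      have spanning: "\<exists>c. v = (\<Sum>i\<in>UNIV. c i *s ?n i)" for v
      proof -
        obtain x where "G *v x = v"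
          using G by (metis invertible_det_nz invertible_right_inverse matrix_right_invertible_surjective surjD)
        then have "v = (\<Sum>i\<in>UNIV. x $ i *s column i G)" by (simp add: matrix_mult_sum)
        also have "\<dots> = (\<Sum>i\<in>UNIV. (x $ i * of_real (norm (p i))) *s ?n i)"
          unfolding n_col using nz by (simp add: vector_smult_assoc)
        finally show ?thesis by (rule exI[of _ "\<lambda>i. x $ i * of_real (norm (p i))"])
      qed
      show ?thesis
        by (rule generic_flags_irreducible[OF sub inv_n inv_m generic separating spanning])
    qed
    then show "\<forall>W. common_invariant M W \<longrightarrow> W = {0} \<or> W = UNIV" by blast
  qed
qed

theorem theorem7:
  fixes \<alpha>1 \<alpha>2 \<beta>1 \<beta>2 \<delta>1 \<delta>2 \<gamma> :: real
  assumes "\<alpha>1 > \<alpha>2" "\<alpha>2 > 0"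
    and "\<beta>1 > \<beta>2" "\<beta>2 > 0"
    and "\<delta>1 > \<delta>2" "\<delta>2 > 0"
    and "\<alpha>1 + \<alpha>2 + \<beta>1 + \<beta>2 + \<delta>1 + \<delta>2 = 3 * \<gamma>"
  shows "(\<exists>\<pi> :: (E6_gen list \<Rightarrow>\<^sub>0 complex) set \<Rightarrow> complex ^ 3 ^ 3.
            star_representation (E6_algebra \<alpha>1 \<alpha>2 \<beta>1 \<beta>2 \<delta>1 \<delta>2 \<gamma>) \<pi> \<and>
            irreducible_representation (E6_algebra \<alpha>1 \<alpha>2 \<beta>1 \<beta>2 \<delta>1 \<delta>2 \<gamma>) \<pi> \<and>
            generalized_dimension \<alpha>1 \<alpha>2 \<beta>1 \<beta>2 \<delta>1 \<delta>2 \<gamma> \<pi> = ((1, 1), (1, 1), (1, 1), 3))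
    \<longleftrightarrow>
         2 * (\<alpha>1 + \<beta>1) > \<alpha>2 + \<beta>2 + \<delta>1 + \<delta>2 \<and>
         2 * (\<alpha>1 + \<delta>1) > \<alpha>2 + \<beta>1 + \<beta>2 + \<delta>2 \<and>
         2 * (\<beta>1 + \<delta>1) > \<alpha>1 + \<alpha>2 + \<beta>2 + \<delta>2 \<and>
         \<alpha>1 + \<alpha>2 + \<beta>1 + \<delta>1 > 2 * (\<beta>2 + \<delta>2) \<and>
         2 * (\<alpha>2 + \<beta>2 + \<delta>1) > \<alpha>1 + \<beta>1 + \<delta>2 \<and>
         \<alpha>1 + \<beta>1 + \<beta>2 + \<delta>1 > 2 * (\<alpha>2 + \<delta>2) \<and>
         2 * (\<alpha>2 + \<beta>1 + \<delta>2) > \<alpha>1 + \<beta>2 + \<delta>1 \<and>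
         2 * (\<alpha>1 + \<beta>2 + \<delta>2) > \<alpha>2 + \<beta>1 + \<delta>1 \<and>
         \<alpha>1 + \<alpha>2 + \<beta>1 + \<beta>2 + \<delta>2 > 2 * \<delta>1 \<and>
         \<alpha>1 + \<beta>1 + \<delta>1 + \<delta>2 > 2 * (\<alpha>2 + \<beta>2) \<and>
         \<alpha>1 + \<alpha>2 + \<beta>2 + \<delta>1 + \<delta>2 > 2 * \<beta>1 \<and>
         \<alpha>2 + \<beta>1 + \<beta>2 + \<delta>1 + \<delta>2 > 2 * \<alpha>1"
proof -
  have card: "CARD(3) = 3" by simp
  note iff = E6_representation_iff_matrices[where 'n = 3, of \<alpha>1 \<alpha>2 \<beta>1 \<beta>2 \<delta>1 \<delta>2 \<gamma>, unfolded card]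
  show ?thesis (is "?L \<longleftrightarrow> ?R")
  proof
    assume ?L
    then obtain M :: "E6_gen \<Rightarrow> complex ^ 3 ^ 3" where M: "E6_relations \<alpha>1 \<alpha>2 \<beta>1 \<beta>2 \<delta>1 \<delta>2 \<gamma> M"
      "\<And>x. rank (M x) = 1" "\<forall>W. common_invariant M W \<longrightarrow> W = {0} \<or> W = UNIV"
      unfolding iff by blast
    show ?R using irreducible_imp_strict_horn[OF M assms(1-6)] assms(7)
      unfolding distrib_left by (intro conjI; linarith)
  next
    assume ?R
    then have "\<gamma> < \<alpha>1 + \<beta>1" "\<gamma> < \<alpha>1 + \<delta>1" "\<gamma> < \<beta>1 + \<delta>1"
      "\<gamma> < \<alpha>1 + \<beta>2 + \<delta>2" "\<gamma> < \<alpha>2 + \<beta>1 + \<delta>2" "\<gamma> < \<alpha>2 + \<beta>2 + \<delta>1"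
      "\<alpha>1 < \<gamma>" "\<beta>1 < \<gamma>" "\<delta>1 < \<gamma>" "\<alpha>2 + \<beta>2 < \<gamma>" "\<alpha>2 + \<delta>2 < \<gamma>" "\<beta>2 + \<delta>2 < \<gamma>"
      using assms(7) unfolding distrib_left by (elim conjE; linarith)+
    then obtain M :: "E6_gen \<Rightarrow> complex ^ 3 ^ 3" where "E6_relations \<alpha>1 \<alpha>2 \<beta>1 \<beta>2 \<delta>1 \<delta>2 \<gamma> M"
      "\<And>x. rank (M x) = 1" "\<forall>W. common_invariant M W \<longrightarrow> W = {0} \<or> W = UNIV"
      using strict_horn_imp_irreducible[OF assms] by metis
    then show ?L unfolding iff by blast
  qed
qed

end
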